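(* Let $G$ be a finite connected metric graph with edge lengths $\ell\in(0,\infty)^E$. One has $$\mathcal R_G^{\mathrm{reg}}\subseteq\mathcal M_G^{\mathrm{bc}}$$ whenever $G$ is a tree, $G$ is unicyclic, or $G$ is closed (no exterior vertices, standard Kirchhoff conditions at every vertex) with $\beta_1(G)=|E|-|V|+1=2$. Consequently, in each of these classes the singular-completion variational problem gives a lower bound for every regular secular observation ratio: for every $r\in\mathcal R_G^{\mathrm{reg}}$ and every $\alpha\in[0,\infty)^E$, $$\frac{\alpha\cdot r}{\ell\cdot r}\ge C_{\mathrm{sing}}(\alpha;\ell).$$
   Context: **Graphs.** $G=(V,E)$ is finite (loops and multiple edges allowed). Its vertices are split into internal vertices $V_{\mathrm{int}}$, of degree at least two, carrying the standard Kirchhoff condition, and exterior vertices, which are exactly the degree-one vertices, each carrying a Dirichlet or Neumann condition. Every edge has at least one internal endpoint, so edges are internal--internal, internal--Dirichlet or internal--Neumann. Orient the edges, terminal edges from the internal to the exterior endpoint. Unicyclic means connected with exactly one independent cycle. **Singular cone.** A boundary-compatible singular sector $\sigma$ consists of: a parity $\sigma_e=\cos\theta_e\in\{\pm1\}$, $\theta_e\in\pi\mathbb Z$, for each internal--internal edge; a phase class $\theta_e\in\pi\mathbb Z$ for each internal--Dirichlet edge; a phase class $\theta_e\in\frac\pi2+\pi\mathbb Z$ for each internal--Neumann edge. $B_{\sigma,\mathrm{bc}}\in\mathbb R^{V_{\mathrm{int}}\times E}$ has: for a non-loop internal--internal edge from $v_-$ to $v_+$, entries $1$ in row $v_-$ and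 $-\sigma_e$ in row $v_+$; for a loop at $v$, entry $1-\sigma_e$ in row $v$; for a terminal edge at internal vertex $v$, entry $1$ in row $v$; all other entries zero. With $A^{\circ2}=(A_e^2)_e$, $\mathcal M_G^{\mathrm{bc}}$ is the convex cone generated by $\bigcup_\sigma\{A^{\circ2}:A\in\ker B_{\sigma,\mathrm{bc}}\}$. $$C_{\mathrm{sing}}(\alpha;\ell)=\min_\sigma\ \inf_{0\ne A\in\ker B_{\sigma,\mathrm{bc}}}\frac{\sum_e\alpha_eA_e^2}{\sum_e\ell_eA_e^2}$$ (sectors with trivial kernel omitted). **Regular edge energies.** A regular scalar secular state at a phase vector $\theta\in(\mathbb R/2\pi\mathbb Z)^E$ consists of real vertex values $\phi_v$ ($v\in V_{\mathrm{int}}$) and real normalized outward derivatives $p_{v,e}$, one for each incidence of an edge with an internal vertex (two for a loop), not all zero, such that: at each internal vertex the $p_{v,e}$ over all incidences sum to $0$; for each internal--internal edge $e=vw$, $\theta_e\notin\pi\mathbb Z$, $\phi_w=\phi_v\cos\theta_e+p_{v,e}\sin\theta_e$ and $-p_{w,e}=-\phi_v\sin\theta_e+p_{v,e}\cos\theta_e$; for each terminal edge at $v$, $\phi_v\cos\theta_e+p_{v,e}\sin\theta_e=0$ (Dirichlet) or $-\phi_v\sin\theta_e+p_{v,e}\cos\theta_e=0$ (Neumann). Its edge-energy vector is $r_e=\phi_v^2+p_{v,e}^2$ (the same at both internal endpoints); it equals $|A_e|^2+|B_e|^2$ for $u_e(x)=A_e\cos kx+B_e\sin kx$, $k\ell_e\equiv\theta_e$.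 $\mathcal R_G^{\mathrm{reg}}$ is the set of all such vectors $r$. *)

theory Defs
  imports "HOL-Analysis.Analysis" "Graph_Theory.Digraph_Component"
begin

text \<open>
  A finite multigraph, loops allowed, together with an orientation of its edges is a
  \<^typ>\<open>('v, 'e) pre_digraph\<close>.  The edges are all elements of a finite type
  \<^typ>\<open>'e\<close>, so that vectors indexed by edges live in \<^typ>\<open>real^'e\<close>.
\<close>

text \<open>A loop contributes 2 to the degree of its vertex.\<close>

definition degree :: "('v, 'e) pre_digraph \<Rightarrow> 'v \<Rightarrow> nat" where
  "degree G v = in_degree G v + out_degree G v"

definition internal :: "('v, 'e) pre_digraph \<Rightarrow> 'v set" where
  "internal G = {v \<in> verts G. degree G v \<ge> 2}"

definition exterior :: "('v, 'e) pre_digraph \<Rightarrow> 'v set" where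
  "exterior G = {v \<in> verts G. degree G v = 1}"

text \<open>
  The assumption \<open>tail_internal\<close> says that every edge has an internal endpoint and that terminal
  edges are oriented from the internal to the exterior endpoint.  Connectedness is that of the
  underlying undirected graph.
\<close>

locale metric_graph = fin_digraph G
  for G :: "('v, 'e::finite) pre_digraph" +
  fixes len :: "real^'e"
  assumes arcs_UNIV: "arcs G = UNIV"
    and connected: "Digraph_Component.connected G"
    and verts_split: "verts G = internal G \<union> exterior G"
    and tail_internal: "\<And>e. tail G e \<in> internal G"
    and len_pos: "\<And>e. len $ e > 0"

text \<open>
  The constant \<^const>\<open>Digraph_Component.tree\<close> only excludes directed cycles, hence does not fit
  here.  Below, a cycle traverses distinct edges irrespective of their orientation; a loop is a
  cycle of length 1, a pair of parallel edges one of length 2.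
\<close>

definition undirected_cycle :: "('v, 'e) pre_digraph \<Rightarrow> 'v list \<Rightarrow> 'e list \<Rightarrow> bool" where
  "undirected_cycle G vs es \<longleftrightarrow>
     es \<noteq> [] \<and> length vs = length es \<and> distinct vs \<and> distinct es \<and> set es \<subseteq> arcs G \<and>
     (\<forall>i < length es.
        {tail G (es ! i), head G (es ! i)} = {vs ! i, vs ! (Suc i mod length es)})"

definition tree_graph :: "('v, 'e) pre_digraph \<Rightarrow> bool" where
  "tree_graph G \<longleftrightarrow>
     Digraph_Component.connected G \<and> \<not> (\<exists>vs es. undirected_cycle G vs es)"

definition betti1 :: "('v, 'e) pre_digraph \<Rightarrow> int" where
  "betti1 G = int (card (arcs G)) - int (card (verts G)) + 1"

definition unicyclic :: "('v, 'e) pre_digraph \<Rightarrow> bool" where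
  "unicyclic G \<longleftrightarrow> Digraph_Component.connected G \<and> betti1 G = 1"

definition closed_graph :: "('v, 'e) pre_digraph \<Rightarrow> bool" where
  "closed_graph G \<longleftrightarrow> exterior G = {}"

text \<open>The function \<open>bc\<close> below matters only on the exterior vertices.\<close>

datatype boundary_condition = Dirichlet | Neumann

definition internal_edge :: "('v, 'e) pre_digraph \<Rightarrow> 'e \<Rightarrow> bool" where
  "internal_edge G e \<longleftrightarrow> tail G e \<in> internal G \<and> head G e \<in> internal G"

text \<open>
  The classes modulo \<open>2 * pi\<close> are represented by their members in the interval from 0 to
  \<open>2 * pi\<close>.  The parity of an internal edge \<open>e\<close> is \<^term>\<open>cos (\<theta> $ e)\<close>.
\<close>

definition singular_sectors ::
  "('v, 'e::finite) pre_digraph \<Rightarrow> ('v \<Rightarrow> boundary_condition) \<Rightarrow> (real^'e) set" where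
  "singular_sectors G bc = {\<theta>. \<forall>e.
     if internal_edge G e then \<theta> $ e \<in> {0, pi}
     else case bc (head G e) of
         Dirichlet \<Rightarrow> \<theta> $ e \<in> {0, pi}
       | Neumann \<Rightarrow> \<theta> $ e \<in> {pi / 2, 3 * pi / 2}}"

definition B_matrix ::
  "('v, 'e::finite) pre_digraph \<Rightarrow> real^'e \<Rightarrow> 'v \<Rightarrow> 'e \<Rightarrow> real" where
  "B_matrix G \<theta> v e =
     (if internal_edge G e then
        (if tail G e = head G e then (if v = tail G e then 1 - cos (\<theta> $ e) else 0)
         else if v = tail G e then 1
         else if v = head G e then - cos (\<theta> $ e)
         else 0)
      else (if v = tail G e then 1 else 0))"

text \<open>Only the rows indexed by internal vertices count.\<close>

definition B_kernel :: "('v, 'e::finite) pre_digraph \<Rightarrow> real^'e \<Rightarrow> (real^'e) set" where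
  "B_kernel G \<theta> = {A. \<forall>v \<in> internal G. (\<Sum>e\<in>UNIV. B_matrix G \<theta> v e * A $ e) = 0}"

definition squares :: "real^'e \<Rightarrow> real^'e" where
  "squares A = (\<chi> e. (A $ e)\<^sup>2)"

definition singular_cone ::
  "('v, 'e::finite) pre_digraph \<Rightarrow> ('v \<Rightarrow> boundary_condition) \<Rightarrow> (real^'e) set" where
  "singular_cone G bc =
     convex_cone hull (\<Union>\<theta> \<in> singular_sectors G bc. squares ` B_kernel G \<theta>)"

text \<open>
  If every sector has a trivial kernel, then the minimum is over the empty set and its value is
  unspecified.
\<close>

definition C_sing ::
  "('v, 'e::finite) pre_digraph \<Rightarrow> ('v \<Rightarrow> boundary_condition) \<Rightarrow> real^'e \<Rightarrow> real^'e \<Rightarrow> real" where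
  "C_sing G bc \<alpha> len =
     (MIN \<theta> \<in> {\<theta> \<in> singular_sectors G bc. B_kernel G \<theta> \<noteq> {0}}.
        INF A \<in> B_kernel G \<theta> - {0}.
          (\<Sum>e\<in>UNIV. \<alpha> $ e * (A $ e)\<^sup>2) / (\<Sum>e\<in>UNIV. len $ e * (A $ e)\<^sup>2))"

text \<open>
  In a regular state, \<open>pt $ e\<close> and \<open>ph $ e\<close> are the normalized outward derivatives at the tail and
  at the head of \<open>e\<close>; a loop has both of them at its vertex.  The value \<open>ph $ e\<close> is meaningless
  for a terminal edge, and so is \<open>\<phi> v\<close> for a vertex \<open>v\<close> that is not internal; neither is
  constrained, and neither counts for nontriviality.  The phase vector is given by a real lift.
\<close>

definition regular_state ::
  "('v, 'e::finite) pre_digraph \<Rightarrow> ('v \<Rightarrow> boundary_condition) \<Rightarrow> real^'e \<Rightarrow>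
   ('v \<Rightarrow> real) \<Rightarrow> real^'e \<Rightarrow> real^'e \<Rightarrow> bool" where
  "regular_state G bc \<theta> \<phi> pt ph \<longleftrightarrow>
     ((\<exists>v \<in> internal G. \<phi> v \<noteq> 0) \<or> (\<exists>e. pt $ e \<noteq> 0) \<or>
        (\<exists>e. internal_edge G e \<and> ph $ e \<noteq> 0)) \<and>
     (\<forall>v \<in> internal G. (\<Sum>e \<in> out_arcs G v. pt $ e) + (\<Sum>e \<in> in_arcs G v. ph $ e) = 0) \<and>
     (\<forall>e. internal_edge G e \<longrightarrow>
        (\<forall>k::int. \<theta> $ e \<noteq> of_int k * pi) \<and>
        \<phi> (head G e) = \<phi> (tail G e) * cos (\<theta> $ e) + pt $ e * sin (\<theta> $ e) \<and>
        - ph $ e = - \<phi> (tail G e) * sin (\<theta> $ e) + pt $ e * cos (\<theta> $ e)) \<and>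
     (\<forall>e. \<not> internal_edge G e \<longrightarrow>
        (case bc (head G e) of
           Dirichlet \<Rightarrow> \<phi> (tail G e) * cos (\<theta> $ e) + pt $ e * sin (\<theta> $ e) = 0
         | Neumann \<Rightarrow> - \<phi> (tail G e) * sin (\<theta> $ e) + pt $ e * cos (\<theta> $ e) = 0))"

definition edge_energy ::
  "('v, 'e::finite) pre_digraph \<Rightarrow> ('v \<Rightarrow> real) \<Rightarrow> real^'e \<Rightarrow> real^'e" where
  "edge_energy G \<phi> pt = (\<chi> e. (\<phi> (tail G e))\<^sup>2 + (pt $ e)\<^sup>2)"

definition regular_energies ::
  "('v, 'e::finite) pre_digraph \<Rightarrow> ('v \<Rightarrow> boundary_condition) \<Rightarrow> (real^'e) set" where
  "regular_energies G bc = {edge_energy G \<phi> pt | \<theta> \<phi> pt ph. regular_state G bc \<theta> \<phi> pt ph}"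

end

theory Submission
  imports Defs
begin

text \<open>
  Cut every edge into two halves, each based at one endpoint and carrying the outward derivative
  there. A singular state is a family of real numbers on the halves that sums to zero at every
  internal vertex and has equal squares on the two halves of each internal edge; the parity of the
  edge absorbs the sign. So a vector belongs to the singular cone as soon as it is a sum of vectors
  of such squares.

  At a single vertex this is plane geometry. A regular state with value \<open>x\<close> at the
  vertex has energies \<open>x\<^sup>2 + p\<^sup>2\<close> with derivatives \<open>p\<close> that
  add up to zero, and their square roots satisfy the polygon inequality. They are therefore the side
  lengths of a closed polygon (\<open>regular_polygon\<close>), and the two coordinates of its sides
  are two families that sum to zero and whose squares add up to the energies. What remains is to
  make the pieces at different vertices agree along the edges.

  Measure each piece relative to the energy: on a half with energy \<open>r\<close> the piece is
  \<open>r * z\<close> with a weight \<open>z\<close>, and the weight vector that is constantly 1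
  has to be a sum of admissible ones. Two parts of the graph that meet in one edge are joined by
  multiplying each piece of either part by the weight that the piece of the other part has on the
  common edge: the two weights then agree there. This is bilinear, so it passes to the generated
  cones (\<open>splits_join\<close>), and a tree is assembled vertex by vertex.

  A cycle is cut open at one edge outside a spanning tree. The polygon at a vertex can be rotated
  until two chosen sides are mirror images in the real axis, after which these two sides have the
  same weight in both pieces. Doing so along the path that connects the two halves of the cut edge
  forces them to have the same weight throughout, so that they can be glued together
  (\<open>splits_tree\<close>).

  In a closed graph with first Betti number 2, two edges are cut and the spanning tree has four free
  halves. All degrees are 2 except for one vertex of degree 4 or two of degree 3. In the first case
  the constant weights are admissible, because the four free energies are equal in pairs. In the
  second case either each cut edge returns to the vertex of degree 3 that it comes from, and the
  mirror argument works on both sides of the bridge (\<open>splits_dumbbell\<close>), or the two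
  triangles have the same sides, and one copies the pieces from one triangle to the other
  (\<open>splits_theta\<close>).

  The bound on the observation ratio is a linear inequality in the energy vector. It holds on the
  generators of the singular cone by the definition of the infimum, hence on the whole cone.
\<close>

section \<open>Closed polygons\<close>

text \<open>
  Greedily put each new number on the lighter side.
\<close>
lemma balanced_bipartition:
  fixes c :: "'a \<Rightarrow> real"
  assumes "finite A" "\<And>a. a \<in> A \<Longrightarrow> 0 \<le> c a \<and> c a \<le> M" "0 \<le> M"
  shows "\<exists>B\<subseteq>A. \<bar>sum c B - sum c (A - B)\<bar> \<le> M"
  using assms(1,2)
proof (induction A rule: finite_induct)
  case empty
  then show ?case using assms(3) by auto
next
  case (insert x A)
  then obtain B where B: "B \<subseteq> A" "\<bar>sum c B - sum c (A - B)\<bar> \<le> M"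
    by auto
  have x: "0 \<le> c x" "c x \<le> M" using insert.prems by auto
  have fin: "finite B" "x \<notin> B" using B insert finite_subset by auto
  show ?case
  proof (cases "sum c B \<le> sum c (A - B)")
    case True
    have "insert x A - insert x B = A - B" using insert by auto
    then show ?thesis
      using True B x fin by (intro exI[of _ "insert x B"]) auto
  next
    case False
    have "insert x A - B = insert x (A - B)" using fin by auto
    then show ?thesis
      using False B x fin insert.hyps by (intro exI[of _ B]) (auto simp: finite_Diff)
  qed
qed

text \<open>
  Split the sides other than the longest one, \<open>m\<close>, into two almost equally long rods
  and open the hinge between them from 0 to \<open>pi\<close>. The distance of the free ends goes
  from at least \<open>c m\<close> to at most \<open>c m\<close>, so that at some angle the longest
  side closes the polygon.
\<close>
lemma closed_polygon:
  fixes c :: "'a \<Rightarrow> real"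
  assumes "finite A" "m \<in> A" "\<And>a. a \<in> A \<Longrightarrow> 0 \<le> c a \<and> c a \<le> c m"
    and "c m \<le> sum c (A - {m})"
  obtains u where "\<And>a. cmod (u a) = 1" "(\<Sum>a\<in>A. of_real (c a) * u a) = 0"
proof -
  obtain B where B: "B \<subseteq> A - {m}" "\<bar>sum c B - sum c (A - {m} - B)\<bar> \<le> c m"
    using balanced_bipartition[of "A - {m}" c "c m"] assms by auto
  define f where "f t = of_real (sum c B) + cis t * of_real (sum c (A - {m} - B))" for t
  have f_sum: "f t = (\<Sum>a\<in>A - {m}. of_real (c a) * (if a \<in> B then 1 else cis t))" for t
  proof -
    have "(\<Sum>a\<in>A - {m}. of_real (c a) * (if a \<in> B then 1 else cis t))
       = (\<Sum>a\<in>A - {m} - B. of_real (c a) * (if a \<in> B then 1 else cis t))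
        + (\<Sum>a\<in>B. of_real (c a) * (if a \<in> B then 1 else cis t))"
      by (rule sum.subset_diff) (use B assms in auto)
    also have "\<dots> = (\<Sum>a\<in>A - {m} - B. of_real (c a) * cis t) + (\<Sum>a\<in>B. of_real (c a))"
      by (intro arg_cong2[where f = "(+)"] sum.cong) auto
    also have "\<dots> = f t"
      by (simp add: f_def sum_distrib_left mult.commute)
    finally show ?thesis by simp
  qed
  have "sum c (A - {m}) = sum c (A - {m} - B) + sum c B"
    by (rule sum.subset_diff) (use B assms in auto)
  moreover have "f 0 = of_real (sum c B + sum c (A - {m} - B))"
    by (simp add: f_def)
  ultimately have f0: "c m \<le> cmod (f 0)"
    using assms(4) by (simp only: norm_of_real)
  have "f pi = of_real (sum c B - sum c (A - {m} - B))"
    by (simp add: f_def)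
  then have fpi: "cmod (f pi) \<le> c m"
    using B(2) by (simp only: norm_of_real)
  have "\<exists>t\<ge>0. t \<le> pi \<and> cmod (f t) = c m"
  proof (rule IVT2')
    show "continuous_on {0..pi} (\<lambda>t. cmod (f t))"
      unfolding f_def by (intro continuous_intros)
  qed (use f0 fpi in auto)
  then obtain t where t: "cmod (f t) = c m" by auto
  \<comment> \<open>If \<open>f t = 0\<close>, then also \<open>c m = 0\<close>, and any direction will do.\<close>
  define w where "w = (if f t = 0 then 1 else - (f t / of_real (c m)))"
  have w: "cmod w = 1" "of_real (c m) * w = - f t"
    using t assms(3)[OF assms(2)] by (auto simp: w_def norm_divide)
  define u where "u a = (if a = m then w else if a \<in> B then 1 else cis t)" for a
  have "(\<Sum>a\<in>A. of_real (c a) * u a) = of_real (c m) * u m + (\<Sum>a\<in>A - {m}. of_real (c a) * u a)"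
    using assms by (simp add: sum.remove)
  also have "(\<Sum>a\<in>A - {m}. of_real (c a) * u a) = f t"
    unfolding f_sum by (rule sum.cong) (auto simp: u_def)
  finally have "(\<Sum>a\<in>A. of_real (c a) * u a) = 0" using w by (simp add: u_def)
  moreover have "cmod (u a) = 1" for a using w by (auto simp: u_def)
  ultimately show thesis using that by blast
qed

text \<open>
  The polygon inequality for the longest side \<open>m\<close>: the vectors \<open>(x, p n)\<close>
  and \<open>(0, p a)\<close> for the remaining sides \<open>a\<close> add up to \<open>(x, - p
  m)\<close>. A second side \<open>n\<close> is there to supply the component \<open>x\<close>.
\<close>
lemma regular_polygon:
  fixes p :: "'a \<Rightarrow> real"
  assumes "finite A" "2 \<le> card A" "sum p A = 0"
  obtains u where "\<And>a. cmod (u a) = 1"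
    "(\<Sum>a\<in>A. of_real (sqrt (x\<^sup>2 + (p a)\<^sup>2)) * u a) = 0"
proof -
  define c where "c a = sqrt (x\<^sup>2 + (p a)\<^sup>2)" for a
  have "A \<noteq> {}" using assms by auto
  then have "Max (c ` A) \<in> c ` A" using assms(1) by (intro Max_in) auto
  then obtain m where m: "m \<in> A" "Max (c ` A) = c m" by blast
  have le_m: "c a \<le> c m" if "a \<in> A" for a
    unfolding m(2)[symmetric] using assms(1) that by (intro Max_ge) auto
  have "\<exists>n. n \<in> A - {m}"
  proof (rule ccontr)
    assume "\<not> ?thesis"
    then have "A = {m}" using m(1) by blast
    then show False using assms by simp
  qed
  then obtain n where n: "n \<in> A - {m}" by blast
  have "p m + (p n + sum p (A - {m} - {n})) = 0"
    using assms m n by (simp add: sum.remove)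
  then have pm: "Complex x (- p m) = Complex x (p n) + (\<Sum>a\<in>A - {m} - {n}. Complex 0 (p a))"
    by (auto simp: complex_eq_iff)
  have "c m = cmod (Complex x (- p m))" by (simp add: c_def cmod_def)
  also have "\<dots> \<le> cmod (Complex x (p n)) + (\<Sum>a\<in>A - {m} - {n}. cmod (Complex 0 (p a)))"
    unfolding pm by (intro norm_triangle_le add_left_mono norm_sum)
  also have "\<dots> \<le> c n + sum c (A - {m} - {n})"
    by (intro add_mono sum_mono) (auto simp: c_def cmod_def)
  also have "\<dots> = sum c (A - {m})"
    using n assms by (simp add: sum.remove)
  finally have "c m \<le> sum c (A - {m})" .
  then show thesis
    using closed_polygon[of A m c] that m(1) le_m assms(1) by (auto simp: c_def)
qed

lemma Re_Im_squares_unit: "cmod z = 1 \<Longrightarrow> (Re z)\<^sup>2 + (Im z)\<^sup>2 = 1"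
  by (simp add: cmod_def)

lemma rotate_to_mirror:
  assumes "cmod z = 1" "cmod z' = 1"
  obtains w where "cmod w = 1" "w * z = cnj (w * z')"
proof
  \<comment> \<open>The condition on \<open>w\<close> is \<open>w\<^sup>2 = cnj (z * z')\<close>, because \<open>z\<close> and \<open>w\<close> have modulus 1.\<close>
  define w where "w = csqrt (cnj (z * z'))"
  have sq: "w * w = cnj (z * z')"
    unfolding w_def by (metis power2_csqrt power2_eq_square)
  have "cmod w * cmod w = 1"
    using arg_cong[OF sq, of cmod] assms by (simp add: norm_mult)
  then show "cmod w = 1"
    by (smt (verit) norm_ge_zero mult_cancel_left1 mult_left_less_imp_less mult_less_cancel_left1)
  then have w: "w * cnj w = 1" by (simp add: complex_norm_square[symmetric])
  have z: "z * cnj z = 1" using assms by (simp add: complex_norm_square[symmetric])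
  have "w * z = (w * w) * z * cnj w" using w by (simp add: mult_ac)
  also have "\<dots> = cnj z' * cnj w * (z * cnj z)" by (simp add: sq mult_ac)
  finally show "w * z = cnj (w * z')" using z by (simp add: mult_ac)
qed

lemma card_3_obtain:
  assumes "card A = 3" "x \<in> A"
  obtains y z where "A = {x, y, z}" "distinct [x, y, z]"
proof -
  have "card (A - {x}) = 2" using assms by (simp add: card_Diff_singleton)
  then obtain y z where "A - {x} = {y, z}" "y \<noteq> z" by (meson card_2_iff)
  then show thesis using that[of y z] assms by auto
qed

lemma two_plus_two:
  assumes "distinct [a, b, c, d]" "X \<inter> Y = {}" "X \<union> Y = {a, b, c, d}" "card X = 2"
  shows "X = {a, b} \<and> Y = {c, d} \<or> X = {c, d} \<and> Y = {a, b} \<or> X = {a, c} \<and> Y = {b, d} \<or>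
    X = {a, d} \<and> Y = {b, c} \<or> X = {b, c} \<and> Y = {a, d} \<or> X = {b, d} \<and> Y = {a, c}"
proof -
  obtain P where P: "X = set (filter P [a, b, c, d])" "Y = set (filter (\<lambda>x. \<not> P x) [a, b, c, d])"
  proof
    show "X = set (filter (\<lambda>x. x \<in> X) [a, b, c, d])" using assms(3) by auto
    show "Y = set (filter (\<lambda>x. \<not> x \<in> X) [a, b, c, d])" using assms(2,3) by auto
  qed
  show ?thesis
    using assms(1,4) unfolding P
    by (cases "P a"; cases "P b"; cases "P c"; cases "P d") simp_all
qed

section \<open>Splitting energies into balanced squares\<close>

text \<open>
  The halves of the edges form the type \<^typ>\<open>'h\<close>, and the set \<open>V\<close> plays
  the role of the internal vertices. In this form an edge can be cut without changing the graph: one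
  just does not ask its two halves to agree.
\<close>
locale balanced_network =
  fixes base :: "'h::finite \<Rightarrow> 'v" and edge :: "'h \<Rightarrow> 'e::finite" and V :: "'v set" and r :: "'e \<Rightarrow> real"
  assumes finite_V: "finite V"
    and halves_of_edge: "\<And>g g' h. edge g = edge g' \<Longrightarrow> g \<noteq> g' \<Longrightarrow> edge h = edge g \<Longrightarrow> h = g \<or> h = g'"
    and two_halves: "\<And>v. v \<in> V \<Longrightarrow> 2 \<le> card {h. base h = v}"
    and regular: "\<And>v. v \<in> V \<Longrightarrow> \<exists>x p. (\<forall>h. base h = v \<longrightarrow> r (edge h) = x\<^sup>2 + (p h)\<^sup>2) \<and>
      sum p {h. base h = v} = 0"
begin

text \<open>
  A weight \<open>z\<close> stands for the squares \<open>r * z\<close>. Weights, rather than the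
  squares, keep the gluing below free of divisions and cover edges of energy zero.
\<close>
definition balanced :: "(real^'h) \<Rightarrow> 'v \<Rightarrow> bool" where
  "balanced z v \<longleftrightarrow> (\<exists>p. (\<forall>h. base h = v \<longrightarrow> (p h)\<^sup>2 = r (edge h) * z $ h) \<and>
     sum p {h. base h = v} = 0)"

definition weights :: "'v set \<Rightarrow> ('h \<times> 'h) set \<Rightarrow> (real^'h) set" where
  "weights S R = {z. (\<forall>h. 0 \<le> z $ h) \<and> (\<forall>v\<in>S. balanced z v) \<and> (\<forall>(h, k)\<in>R. z $ h = z $ k)}"

text \<open>
  As the vector 1 stands for the energies themselves, this says that they are a sum of squares which
  are balanced on \<open>S\<close> and have equal weights on the pairs in \<open>R\<close>.
\<close>
definition splits :: "'v set \<Rightarrow> ('h \<times> 'h) set \<Rightarrow> bool" where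
  "splits S R \<longleftrightarrow> 1 \<in> convex_cone hull weights S R"

definition mates :: "'e set \<Rightarrow> ('h \<times> 'h) set" where
  "mates F = {(h, k). edge h \<in> F \<and> edge k = edge h}"

lemma r_nonneg: "v \<in> V \<Longrightarrow> base h = v \<Longrightarrow> 0 \<le> r (edge h)"
  using regular[of v] by auto

lemma in_weightsD:
  assumes "z \<in> weights S R"
  shows "0 \<le> z $ h" "v \<in> S \<Longrightarrow> balanced z v" "(h, k) \<in> R \<Longrightarrow> z $ h = z $ k"
  using assms by (auto simp: weights_def)

lemma balanced_scaled:
  assumes "balanced z v" "0 \<le> c" "\<And>h. base h = v \<Longrightarrow> y $ h = c * z $ h"
  shows "balanced y v"
proof -
  obtain p where p: "\<forall>h. base h = v \<longrightarrow> (p h)\<^sup>2 = r (edge h) * z $ h" "sum p {h. base h = v} = 0"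
    using assms(1) by (auto simp: balanced_def)
  show ?thesis
    unfolding balanced_def
    by (rule exI[of _ "\<lambda>h. sqrt c * p h"])
      (use p assms(2,3) in \<open>auto simp: power_mult_distrib simp flip: sum_distrib_left\<close>)
qed

lemma splits_by_linear_map:
  assumes "linear f" "splits S R" "f 1 = 1" "f ` weights S R \<subseteq> convex_cone hull weights S' R'"
  shows "splits S' R'"
proof -
  have "f 1 \<in> convex_cone hull (f ` weights S R)"
    using assms(1,2) by (auto simp: splits_def convex_cone_hull_linear_image)
  also have "\<dots> \<subseteq> convex_cone hull weights S' R'"
    by (intro hull_minimal assms(4) convex_cone_convex_cone_hull)
  finally show ?thesis using assms(3) by (simp add: splits_def)
qed

text \<open>
  The weights are the squared coordinates of the unit side directions of a closed polygon with side
  lengths \<open>sqrt r\<close>. If the directions at \<open>h\<close> and \<open>k\<close> are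
  complex conjugates of each other, then their squared coordinates agree.
\<close>
lemma splits_vertex:
  assumes "v \<in> V" "base h = v" "base k = v"
  shows "splits {v} {(h, k)}"
proof -
  obtain x p where p: "\<And>l. base l = v \<Longrightarrow> r (edge l) = x\<^sup>2 + (p l)\<^sup>2" "sum p {l. base l = v} = 0"
    using regular[OF assms(1)] by auto
  obtain u' where u': "\<And>l. cmod (u' l) = 1"
    "(\<Sum>l | base l = v. of_real (sqrt (x\<^sup>2 + (p l)\<^sup>2)) * u' l) = 0"
    using regular_polygon[of "{l. base l = v}" p x] two_halves[OF assms(1)] p(2) by auto
  obtain w where w: "cmod w = 1" "w * u' h = cnj (w * u' k)"
    using rotate_to_mirror u'(1) by metis
  define u where "u l = w * u' l" for l
  have "(\<Sum>l | base l = v. of_real (sqrt (r (edge l))) * u l)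
      = w * (\<Sum>l | base l = v. of_real (sqrt (x\<^sup>2 + (p l)\<^sup>2)) * u' l)"
    unfolding sum_distrib_left by (rule sum.cong) (auto simp: p(1) u_def)
  then have u0: "(\<Sum>l | base l = v. of_real (sqrt (r (edge l))) * u l) = 0"
    using u'(2) by simp
  have u1: "cmod (u l) = 1" for l
    using w u' by (simp add: u_def norm_mult)
  have uhk: "u h = cnj (u k)" using w(2) by (simp add: u_def)
  have "(\<chi> l. (Re (u l))\<^sup>2) \<in> weights {v} {(h, k)}"
    using arg_cong[OF u0, of Re] uhk r_nonneg[OF assms(1)] unfolding weights_def balanced_def
    by (auto simp: power_mult_distrib intro!: exI[of _ "\<lambda>l. sqrt (r (edge l)) * Re (u l)"])
  moreover have "(\<chi> l. (Im (u l))\<^sup>2) \<in> weights {v} {(h, k)}"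
    using arg_cong[OF u0, of Im] uhk r_nonneg[OF assms(1)] unfolding weights_def balanced_def
    by (auto simp: power_mult_distrib intro!: exI[of _ "\<lambda>l. sqrt (r (edge l)) * Im (u l)"])
  moreover have "(\<chi> l. (Re (u l))\<^sup>2) + (\<chi> l. (Im (u l))\<^sup>2) = 1"
    using u1 by (simp add: vec_eq_iff Re_Im_squares_unit)
  ultimately show ?thesis
    unfolding splits_def by (metis convex_cone_hull_add hull_inc)
qed

text \<open>
  The halves \<open>g\<close> and \<open>g'\<close> are those of the edge along which two parts of
  the graph are glued; \<open>g\<close> belongs to the part \<open>S\<close>. Both of them get the
  weight \<open>a $ g * b $ g'\<close>.
\<close>
definition join :: "'v set \<Rightarrow> 'h \<Rightarrow> 'h \<Rightarrow> real^'h \<Rightarrow> real^'h \<Rightarrow> real^'h" where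
  "join S g g' a b = (\<chi> h. if base h \<in> S then a $ h * b $ g' else b $ h * a $ g)"

lemma join_in_weights:
  assumes "a \<in> weights S R" "b \<in> weights T R'" "S \<inter> T = {}"
    and "\<And>h k. (h, k) \<in> R'' \<Longrightarrow> join S g g' a b $ h = join S g g' a b $ k"
  shows "join S g g' a b \<in> weights (S \<union> T) R''"
proof -
  have "balanced (join S g g' a b) v" if "v \<in> S" for v
    by (rule balanced_scaled[of a v "b $ g'"])
      (use that assms in_weightsD[OF assms(1)] in_weightsD[OF assms(2)] in \<open>auto simp: join_def\<close>)
  moreover have "balanced (join S g g' a b) v" if "v \<in> T" for v
    by (rule balanced_scaled[of b v "a $ g"])
      (use that assms in_weightsD[OF assms(1)] in_weightsD[OF assms(2)] in \<open>auto simp: join_def\<close>)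
  ultimately show ?thesis
    using assms(4) in_weightsD(1)[OF assms(1)] in_weightsD(1)[OF assms(2)]
    unfolding weights_def by (auto simp: join_def)
qed

text \<open>
  Joining is bilinear and maps the pair \<open>(1, 1)\<close> to 1; so decompositions of 1 on both
  parts multiply out to a decomposition of 1 on the union.
\<close>
lemma splits_join:
  assumes S: "splits S R" and T: "splits T R'" and "S \<inter> T = {}"
    and R'': "\<And>a b h k. a \<in> weights S R \<Longrightarrow> b \<in> weights T R' \<Longrightarrow> (h, k) \<in> R'' \<Longrightarrow>
      join S g g' a b $ h = join S g g' a b $ k"
  shows "splits (S \<union> T) R''"
proof (rule splits_by_linear_map[OF _ S])
  show "linear (\<lambda>a. join S g g' a 1)"
    by (rule linearI) (auto simp: join_def vec_eq_iff)
  show "join S g g' 1 1 = 1"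
    by (auto simp: join_def vec_eq_iff)
  show "(\<lambda>a. join S g g' a 1) ` weights S R \<subseteq> convex_cone hull weights (S \<union> T) R''"
  proof (rule image_subsetI)
    fix a assume a: "a \<in> weights S R"
    have "linear (join S g g' a)"
      by (rule linearI) (auto simp: join_def vec_eq_iff algebra_simps)
    then have "join S g g' a 1 \<in> convex_cone hull (join S g g' a ` weights T R')"
      using T by (auto simp: splits_def convex_cone_hull_linear_image)
    also have "\<dots> \<subseteq> convex_cone hull weights (S \<union> T) R''"
      by (intro hull_mono image_subsetI join_in_weights[OF a _ assms(3)] R''[OF a]) assumption+
    finally show "join S g g' a 1 \<in> convex_cone hull weights (S \<union> T) R''" .
  qed
qed

text \<open>
  The edges \<open>F\<close> form a tree that spans \<open>S\<close>. Edges outside \<open>F\<close>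
  count as cut, even if both of their endpoints lie in \<open>S\<close>.
\<close>
inductive grown :: "'v \<Rightarrow> 'v set \<Rightarrow> 'e set \<Rightarrow> bool" for v\<^sub>0 where
  root: "grown v\<^sub>0 {v\<^sub>0} {}"
| attach: "grown v\<^sub>0 S F \<Longrightarrow> base g \<in> S \<Longrightarrow> base g' \<in> V - S \<Longrightarrow> edge g = edge g' \<Longrightarrow>
    grown v\<^sub>0 (insert (base g') S) (insert (edge g) F)"

lemma grown_subset: "grown v\<^sub>0 S F \<Longrightarrow> v\<^sub>0 \<in> V \<Longrightarrow> S \<subseteq> V"
  by (induction rule: grown.induct) auto

lemma grown_base: "grown v\<^sub>0 S F \<Longrightarrow> edge h \<in> F \<Longrightarrow> base h \<in> S"
proof (induction rule: grown.induct)
  case (attach S F g g')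
  then have "h = g \<or> h = g' \<or> edge h \<in> F"
    using halves_of_edge[of g g' h] by auto
  then show ?case using attach by auto
qed auto

lemma grown_card: "grown v\<^sub>0 S F \<Longrightarrow> v\<^sub>0 \<in> V \<Longrightarrow> card S = Suc (card F)"
proof (induction rule: grown.induct)
  case (attach S F g g')
  have "finite S" using grown_subset[OF attach(1)] attach finite_V finite_subset by blast
  moreover have "edge g \<notin> F" using grown_base[OF attach(1), of g'] attach by auto
  ultimately show ?case using attach by auto
qed auto

lemma join_mates:
  assumes grown: "grown v\<^sub>0 S F" and g: "base g \<in> S" "base g' \<notin> S" "edge g = edge g'"
    and a: "a \<in> weights S (R \<union> mates F)" and hk: "(h, k) \<in> mates (insert (edge g) F)"
  shows "join S g g' a b $ h = join S g g' a b $ k"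
proof -
  have e: "edge h \<in> insert (edge g) F" "edge k = edge h"
    using hk by (auto simp: mates_def)
  show ?thesis
  proof (cases "edge h \<in> F")
    case True
    then have "a $ h = a $ k"
      using in_weightsD(3)[OF a, of h k] e by (auto simp: mates_def)
    then show ?thesis using grown_base[OF grown] True e by (simp add: join_def)
  next
    case False
    have *: "l = g \<or> l = g'" if "edge l = edge g" for l
      using halves_of_edge[OF g(3) _ that] g by auto
    show ?thesis using *[of h] *[of k] False e g by (auto simp: join_def)
  qed
qed

lemma splits_attach:
  assumes grown: "grown v\<^sub>0 S F" and g: "base g \<in> S" "base g' \<in> V - S" "edge g = edge g'"
    and S: "splits S (R \<union> mates F)" and w: "splits {base g'} R'"
    and R'': "\<And>a b h k. a \<in> weights S (R \<union> mates F) \<Longrightarrow> b \<in> weights {base g'} R' \<Longrightarrow>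
      (h, k) \<in> R'' \<Longrightarrow> join S g g' a b $ h = join S g g' a b $ k"
  shows "splits (insert (base g') S) (R'' \<union> mates (insert (edge g) F))"
proof -
  have "splits (S \<union> {base g'}) (R'' \<union> mates (insert (edge g) F))"
  proof (rule splits_join[OF S w])
    show "S \<inter> {base g'} = {}" using g by auto
    fix a b h k
    assume "a \<in> weights S (R \<union> mates F)" "b \<in> weights {base g'} R'"
      "(h, k) \<in> R'' \<union> mates (insert (edge g) F)"
    then show "join S g g' a b $ h = join S g g' a b $ k"
      using R'' join_mates[OF grown g(1) _ g(3)] g(2) by blast
  qed
  then show ?thesis by simp
qed

lemma splits_swap: "splits S (insert (h, k) R) \<Longrightarrow> splits S (insert (k, h) R)"
  by (simp add: splits_def weights_def eq_commute[of "_ $ h"])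

text \<open>
  Equal weights on \<open>h\<close> and \<open>k\<close> propagate along the tree path between them:
  if \<open>h\<close> agrees with \<open>g\<close> in the old part and \<open>k\<close> agrees with
  \<open>g'\<close> at the new vertex, then \<open>h\<close> and \<open>k\<close> get the same
  product in the join.
\<close>
lemma splits_tree:
  assumes "grown v\<^sub>0 S F" "v\<^sub>0 \<in> V" "base h \<in> S" "base k \<in> S"
  shows "splits S (insert (h, k) (mates F))"
  using assms
proof (induction arbitrary: h k rule: grown.induct)
  case root
  then show ?case using splits_vertex by (simp add: mates_def)
next
  case (attach S F g g')
  let ?w = "base g'"
  note splits_attach = splits_attach[OF attach.hyps]
  have S: "splits S ({(h, k)} \<union> mates F)" if "base h \<in> S" "base k \<in> S" for h k
    using attach.IH that attach.prems by simp
  have w: "splits {?w} {(h, k)}" if "base h = ?w" "base k = ?w" for h k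
    using splits_vertex that attach.hyps by blast
  have *: "splits (insert ?w S) ({(h, k)} \<union> mates (insert (edge g) F))"
    if h: "base h \<in> S" and k: "base k \<in> insert ?w S" for h k
  proof (cases "base k \<in> S")
    case True
    show ?thesis
    proof (rule splits_attach[OF S[OF h True] w[OF refl refl]])
      fix a b l m
      assume "a \<in> weights S ({(h, k)} \<union> mates F)" "(l, m) \<in> {(h, k)}"
      then show "join S g g' a b $ l = join S g g' a b $ m"
        using h True in_weightsD(3)[of a S _ h k] by (auto simp: join_def)
    qed
  next
    case False
    then have kw: "base k = ?w" using k by auto
    show ?thesis
    proof (rule splits_attach[OF S[OF h attach.hyps(2)] w[OF refl kw]])
      fix a b l m
      assume ab: "a \<in> weights S ({(h, g)} \<union> mates F)" "b \<in> weights {?w} {(g', k)}"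
        and lm: "(l, m) \<in> {(h, k)}"
      have "a $ h = a $ g" "b $ g' = b $ k"
        using in_weightsD(3)[OF ab(1), of h g] in_weightsD(3)[OF ab(2), of g' k] by auto
      then show "join S g g' a b $ l = join S g g' a b $ m"
        using lm h False by (auto simp: join_def)
    qed
  qed
  consider "base h \<in> S" | "base k \<in> S" | "base h = ?w" "base k = ?w" "base h \<notin> S"
    using attach.prems by blast
  then show ?case
  proof cases
    case 3
    have "splits (insert ?w S) ({(h, k)} \<union> mates (insert (edge g) F))"
    proof (rule splits_attach[OF S[OF attach.hyps(2,2)] w[OF 3(1,2)]])
      fix a b l m
      assume b: "b \<in> weights {base g'} {(h, k)}" and lm: "(l, m) \<in> {(h, k)}"
      show "join S g g' a b $ l = join S g g' a b $ m"
        using in_weightsD(3)[OF b, of h k] 3 lm by (auto simp: join_def)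
    qed
    then show ?thesis by simp
  qed (use * splits_swap attach.prems in auto)
qed

section \<open>Spanning trees and cycles\<close>

lemma grown_extends:
  assumes "\<And>S. S \<subset> V \<Longrightarrow> S \<noteq> {} \<Longrightarrow> \<exists>g g'. base g \<in> S \<and> base g' \<in> V - S \<and> edge g = edge g'"
    and "v\<^sub>0 \<in> V" "grown v\<^sub>0 S F"
  shows "\<exists>F'. grown v\<^sub>0 V F'"
  using assms(3)
proof (induction "card (V - S)" arbitrary: S F rule: less_induct)
  case less
  have S: "S \<subseteq> V" "v\<^sub>0 \<in> S"
    using grown_subset[OF less.prems assms(2)] less.prems by (auto elim: grown.induct)
  show ?case
  proof (cases "S = V")
    case False
    then obtain g g' where g: "base g \<in> S" "base g' \<in> V - S" "edge g = edge g'"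
      using assms(1)[of S] S by blast
    have "V - insert (base g') S \<subset> V - S" using g by auto
    then have "card (V - insert (base g') S) < card (V - S)"
      using finite_V by (intro psubset_card_mono) auto
    then show ?thesis using less.hyps grown.attach[OF less.prems g] by blast
  qed (use less.prems in auto)
qed

definition tree_path :: "'v set \<Rightarrow> 'e set \<Rightarrow> 'v \<Rightarrow> 'v \<Rightarrow> 'v list \<Rightarrow> 'e list \<Rightarrow> bool" where
  "tree_path S F u v vs es \<longleftrightarrow> length vs = Suc (length es) \<and> distinct vs \<and> distinct es \<and>
     set vs \<subseteq> S \<and> set es \<subseteq> F \<and> hd vs = u \<and> last vs = v \<and>
     (\<forall>i<length es. base ` {h. edge h = es ! i} = {vs ! i, vs ! Suc i})"

lemma grown_tree_path:
  assumes "grown v\<^sub>0 S F" "u \<in> S" "v \<in> S"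
  shows "\<exists>vs es. tree_path S F u v vs es"
  using assms
proof (induction arbitrary: u v rule: grown.induct)
  case root
  then show ?case
    by (intro exI[of _ "[v\<^sub>0]"] exI[of _ "[]"]) (auto simp: tree_path_def)
next
  case (attach S F g g')
  let ?w = "base g'" and ?e = "edge g"
  have "g \<noteq> g'" using attach by auto
  then have "{h. edge h = ?e} = {g, g'}"
    using halves_of_edge[OF attach.hyps(4)] attach.hyps(4) by auto
  then have ends: "base ` {h. edge h = ?e} = {base g, ?w}" by simp
  have new: "?e \<notin> F" using grown_base[OF attach.hyps(1), of g'] attach.hyps by auto
  consider "u \<in> S" "v \<in> S" | "u \<in> S" "v = ?w" | "u = ?w" "v \<in> S" | "u = ?w" "v = ?w"
    using attach.prems by blast
  then show ?case
  proof cases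
    case 1
    then obtain vs es where "tree_path S F u v vs es" using attach.IH by blast
    then have "tree_path (insert ?w S) (insert ?e F) u v vs es"
      unfolding tree_path_def by auto
    then show ?thesis by blast
  next
    case 2
    then obtain vs es where p: "tree_path S F u (base g) vs es" using attach.IH attach.hyps by blast
    have len: "length vs = Suc (length es)" and last: "last vs = base g" using p by (auto simp: tree_path_def)
    then have stop: "vs ! length es = base g" by (metis diff_Suc_1 last_conv_nth list.size(3) nat.distinct(1))
    have "base ` {h. edge h = (es @ [?e]) ! i} = {(vs @ [?w]) ! i, (vs @ [?w]) ! Suc i}"
      if "i < length (es @ [?e])" for i
    proof (cases "i = length es")
      case True
      then show ?thesis using ends stop len by (simp add: nth_append)
    next
      case False
      then show ?thesis using that p len by (auto simp: nth_append tree_path_def)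
    qed
    moreover have "hd (vs @ [?w]) = u" using p by (cases vs) (auto simp: tree_path_def)
    moreover have "?w \<notin> set vs" "?e \<notin> set es" using p attach.hyps(3) new by (auto simp: tree_path_def)
    ultimately have "tree_path (insert ?w S) (insert ?e F) u v (vs @ [?w]) (es @ [?e])"
      using p 2 unfolding tree_path_def by auto
    then show ?thesis by blast
  next
    case 3
    then obtain vs es where p: "tree_path S F (base g) v vs es" using attach.IH attach.hyps by blast
    have len: "length vs = Suc (length es)" and "hd vs = base g" using p by (auto simp: tree_path_def)
    then have start: "vs ! 0 = base g" by (cases vs) auto
    have "base ` {h. edge h = (?e # es) ! i} = {(?w # vs) ! i, (?w # vs) ! Suc i}"
      if "i < length (?e # es)" for i
    proof (cases i)
      case 0
      then show ?thesis using ends start by auto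
    next
      case (Suc j)
      then show ?thesis using that p len by (auto simp: tree_path_def)
    qed
    moreover have "last (?w # vs) = v" using p by (cases vs) (auto simp: tree_path_def)
    moreover have "?w \<notin> set vs" "?e \<notin> set es" using p attach.hyps(3) new by (auto simp: tree_path_def)
    ultimately have "tree_path (insert ?w S) (insert ?e F) u v (?w # vs) (?e # es)"
      using p 3 unfolding tree_path_def by auto
    then show ?thesis by blast
  next
    case 4
    then have "tree_path (insert ?w S) (insert ?e F) u v [?w] []" by (auto simp: tree_path_def)
    then show ?thesis by blast
  qed
qed

section \<open>Two cut edges\<close>

definition leaves :: "'v set \<Rightarrow> 'e set \<Rightarrow> 'h set" where
  "leaves S F = {h. base h \<in> S \<and> edge h \<notin> F}"

text \<open>
  If there are three leaves, then \<open>S\<close> consists of a vertex of degree 3 with chains of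
  vertices of degree 2 attached, and \<open>\<kappa>\<close> sends each half to the leaf at the end
  of its chain: whatever balances over the three leaves extends along the chains.
\<close>
definition transfers :: "'v set \<Rightarrow> 'e set \<Rightarrow> bool" where
  "transfers S F \<longleftrightarrow> (\<exists>\<kappa>. (\<forall>h. base h \<in> S \<longrightarrow> \<kappa> h \<in> leaves S F) \<and>
     (\<forall>h\<in>leaves S F. \<kappa> h = h) \<and> (\<forall>h k. (h, k) \<in> mates F \<longrightarrow> \<kappa> h = \<kappa> k) \<and>
     (\<forall>y p. (\<forall>h\<in>leaves S F. (p h)\<^sup>2 = r (edge h) * y h) \<and> sum p (leaves S F) = 0 \<longrightarrow>
        (\<forall>v\<in>S. balanced (\<chi> h. y (\<kappa> h)) v)))"

text \<open>
  The pairs \<open>(a, b)\<close> and \<open>(c, d)\<close> are to become the two cut edges, whose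
  halves have equal energies.
\<close>
definition pairs_up :: "'v set \<Rightarrow> 'e set \<Rightarrow> bool" where
  "pairs_up S F \<longleftrightarrow> (\<forall>a b c d. distinct [a, b, c, d] \<and> leaves S F = {a, b, c, d} \<and>
     r (edge a) = r (edge b) \<and> r (edge c) = r (edge d) \<longrightarrow> splits S ({(a, b), (c, d)} \<union> mates F))"

lemma leaves_attach:
  assumes "grown v\<^sub>0 S F" "base g \<in> S" "base g' \<in> V - S" "edge g = edge g'"
  shows "g \<in> leaves S F"
    and "leaves (insert (base g') S) (insert (edge g) F)
      = (leaves S F - {g}) \<union> ({h. base h = base g'} - {g'})"
proof -
  have F: "edge g \<notin> F" using grown_base[OF assms(1), of g'] assms by auto
  then show "g \<in> leaves S F" using assms by (simp add: leaves_def)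
  have "g \<noteq> g'" using assms by auto
  then have g: "edge h = edge g \<longleftrightarrow> h = g \<or> h = g'" for h
    using assms(4) halves_of_edge[of g g' h] by auto
  have F': "edge h \<notin> F" if "base h = base g'" for h
    using grown_base[OF assms(1), of h] that assms(3) by auto
  then show "leaves (insert (base g') S) (insert (edge g) F)
      = (leaves S F - {g}) \<union> ({h. base h = base g'} - {g'})"
  proof (intro set_eqI)
    fix h
    show "h \<in> leaves (insert (base g') S) (insert (edge g) F) \<longleftrightarrow>
        h \<in> (leaves S F - {g}) \<union> ({h. base h = base g'} - {g'})"
    proof (cases "base h = base g'")
      case True
      then have "base h \<notin> S" "h \<noteq> g" "edge h \<notin> F" using F' assms by auto
      then show ?thesis using True g[of h] by (auto simp: leaves_def)
    next
      case False
      then show ?thesis using g[of h] by (auto simp: leaves_def)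
    qed
  qed
qed

lemma card_leaves_attach:
  assumes "grown v\<^sub>0 S F" "base g \<in> S" "base g' \<in> V - S" "edge g = edge g'"
  shows "card (leaves (insert (base g') S) (insert (edge g) F)) + 2
      = card (leaves S F) + card {h. base h = base g'}"
proof -
  have "card (leaves (insert (base g') S) (insert (edge g) F))
     = card (leaves S F - {g}) + card ({h. base h = base g'} - {g'})"
    unfolding leaves_attach(2)[OF assms]
    by (rule card_Un_disjoint) (use assms in \<open>auto simp: leaves_def\<close>)
  moreover have "card (leaves S F) = Suc (card (leaves S F - {g}))"
    by (rule card.remove) (use leaves_attach(1)[OF assms] in auto)
  moreover have "card {h. base h = base g'} = Suc (card ({h. base h = base g'} - {g'}))"
    by (rule card.remove) auto
  ultimately show ?thesis by linarith
qed

lemma degree_two_energy: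
  assumes "v \<in> V" "{h. base h = v} = {g, k}" "g \<noteq> k"
  shows "r (edge g) = r (edge k)"
proof -
  obtain x p where p: "\<forall>h. base h = v \<longrightarrow> r (edge h) = x\<^sup>2 + (p h)\<^sup>2" "sum p {h. base h = v} = 0"
    using regular[OF assms(1)] by blast
  have "base g = v" "base k = v" using assms(2) by auto
  moreover have "p g = - p k" using p(2) assms(2,3) by simp
  ultimately show ?thesis using p(1) by simp
qed

text \<open>
  Here 1 itself is admissible: equal energies in each pair cancel with opposite signs.
\<close>
lemma pairs_up_root:
  assumes "v \<in> V"
  shows "pairs_up {v} {}"
  unfolding pairs_up_def
proof (intro allI impI, elim conjE)
  fix a b c d
  assume dist: "distinct [a, b, c, d]" and "leaves {v} {} = {a, b, c, d}"
    and r: "r (edge a) = r (edge b)" "r (edge c) = r (edge d)"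
  then have H: "{h. base h = v} = {a, b, c, d}" by (simp add: leaves_def)
  then have "base a = v" "base c = v" by auto
  then have nn: "0 \<le> r (edge a)" "0 \<le> r (edge c)" using r_nonneg[OF assms] by auto
  define p where "p h = (if h = a then sqrt (r (edge a)) else if h = b then - sqrt (r (edge a))
    else if h = c then sqrt (r (edge c)) else - sqrt (r (edge c)))" for h
  have "p a = - p b" "p c = - p d" using dist by (auto simp: p_def)
  then have "sum p {a, b, c, d} = 0" using dist by simp
  moreover have "(p h)\<^sup>2 = r (edge h)" if "base h = v" for h
  proof -
    have "h \<in> {a, b, c, d}" using H that by auto
    then show ?thesis using dist nn r by (auto simp: p_def)
  qed
  ultimately have "balanced 1 v" unfolding balanced_def H by auto
  then have "1 \<in> weights {v} ({(a, b), (c, d)} \<union> mates {})"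
    by (simp add: weights_def mates_def)
  then show "splits {v} ({(a, b), (c, d)} \<union> mates {})"
    by (simp add: splits_def hull_inc)
qed

lemma transfers_root: "transfers {v} {}"
  unfolding transfers_def leaves_def balanced_def mates_def by (intro exI[of _ id]) auto

text \<open>
  The leaf \<open>g\<close> is replaced by the other half \<open>k\<close> at the new vertex, which
  has the same energy.
\<close>
lemma transfers_attach:
  assumes grown: "grown v\<^sub>0 S F" and g: "base g \<in> S" "base g' \<in> V - S" "edge g = edge g'"
    and tr: "transfers S F" and w: "{h. base h = base g'} = {g', k}" "g' \<noteq> k"
  shows "transfers (insert (base g') S) (insert (edge g) F)"
proof -
  let ?L = "leaves S F" and ?L' = "leaves (insert (base g') S) (insert (edge g) F)"
  obtain \<kappa> where \<kappa>: "\<And>h. base h \<in> S \<Longrightarrow> \<kappa> h \<in> ?L" "\<And>h. h \<in> ?L \<Longrightarrow> \<kappa> h = h"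
      "\<And>h k. (h, k) \<in> mates F \<Longrightarrow> \<kappa> h = \<kappa> k"
    and bal: "\<And>y p v. (\<forall>h\<in>?L. (p h)\<^sup>2 = r (edge h) * y h) \<Longrightarrow> sum p ?L = 0 \<Longrightarrow> v \<in> S \<Longrightarrow>
        balanced (\<chi> h. y (\<kappa> h)) v"
    using tr unfolding transfers_def by blast
  have gL: "g \<in> ?L" and L': "?L' = insert k (?L - {g})"
    using leaves_attach[OF grown g] w by auto
  have kw: "base k = base g'" using w by auto
  have kL: "k \<notin> ?L" using kw g by (auto simp: leaves_def)
  have rg: "r (edge g) = r (edge k)" using degree_two_energy[OF _ w] g by simp
  define \<kappa>' where "\<kappa>' h = (if base h = base g' \<or> \<kappa> h = g then k else \<kappa> h)" for h
  have "\<kappa>' h \<in> ?L'" if "base h \<in> insert (base g') S" for h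
    using that \<kappa>(1)[of h] unfolding L' by (auto simp: \<kappa>'_def)
  moreover have "\<kappa>' h = h" if "h \<in> ?L'" for h
    using that \<kappa>(2)[of h] g(2) kw unfolding L' by (auto simp: \<kappa>'_def leaves_def)
  moreover have "\<kappa>' h = \<kappa>' l" if hl: "(h, l) \<in> mates (insert (edge g) F)" for h l
  proof (cases "edge h \<in> F")
    case True
    then have hl': "(h, l) \<in> mates F" "edge l = edge h" using hl by (auto simp: mates_def)
    then have "base h \<noteq> base g'" "base l \<noteq> base g'"
      using True grown_base[OF grown, of h] grown_base[OF grown, of l] g(2) by auto
    then show ?thesis using \<kappa>(3)[OF hl'(1)] by (simp add: \<kappa>'_def)
  next
    case False
    have "\<kappa>' h = k" if "edge h = edge g" for h
    proof -
      have "g \<noteq> g'" using g by auto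
      then have "h = g \<or> h = g'" using halves_of_edge[OF g(3) _ that] by blast
      then show ?thesis using \<kappa>(2)[OF gL] by (auto simp: \<kappa>'_def)
    qed
    then show ?thesis using False hl by (simp add: mates_def)
  qed
  moreover have "balanced (\<chi> h. y (\<kappa>' h)) v"
    if p: "\<forall>h\<in>?L'. (p h)\<^sup>2 = r (edge h) * y h" "sum p ?L' = 0" and v: "v \<in> insert (base g') S"
    for y p v
  proof (cases "v = base g'")
    case True
    have pk: "(p k)\<^sup>2 = r (edge k) * y k" "r (edge g') = r (edge k)"
      using p(1) L' rg g(3) by auto
    define q where "q h = (if h = k then p k else - p k)" for h
    have "(q h)\<^sup>2 = r (edge h) * y (\<kappa>' h)" if h: "base h = base g'" for h
    proof -
      have "h = g' \<or> h = k" using h w by blast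
      then show ?thesis using pk kw by (auto simp: q_def \<kappa>'_def)
    qed
    moreover have "sum q {g', k} = 0" using w(2) by (simp add: q_def)
    ultimately show ?thesis
      unfolding balanced_def True w by (intro exI[of _ q]) auto
  next
    case False
    define y0 where "y0 h = (if h = g then y k else y h)" for h
    define p0 where "p0 h = (if h = g then p k else p h)" for h
    have "sum p0 ?L = p0 g + sum p0 (?L - {g})" using gL by (simp add: sum.remove)
    also have "sum p0 (?L - {g}) = sum p (?L - {g})" by (rule sum.cong) (auto simp: p0_def)
    also have "p0 g + sum p (?L - {g}) = sum p ?L'" unfolding L' using kL by (simp add: p0_def)
    finally have "sum p0 ?L = 0" using p(2) by simp
    moreover have "\<forall>h\<in>?L. (p0 h)\<^sup>2 = r (edge h) * y0 h"
      using p(1) rg unfolding L' by (auto simp: p0_def y0_def)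
    ultimately have "balanced (\<chi> h. y0 (\<kappa> h)) v" using bal[of p0 y0 v] v False by auto
    then show ?thesis
      using balanced_scaled[of "\<chi> h. y0 (\<kappa> h)" v 1 "\<chi> h. y (\<kappa>' h)"] False
      by (auto simp: \<kappa>'_def y0_def)
  qed
  ultimately show ?thesis unfolding transfers_def by (intro exI[of _ \<kappa>']) blast
qed

lemma splits_pairing_symmetries:
  assumes "splits S ({(a, b), (c, d)} \<union> R)"
  shows "splits S ({(b, a), (c, d)} \<union> R)" "splits S ({(a, b), (d, c)} \<union> R)"
    "splits S ({(c, d), (a, b)} \<union> R)"
proof -
  have "weights S ({(b, a), (c, d)} \<union> R) = weights S ({(a, b), (c, d)} \<union> R)"
    "weights S ({(a, b), (d, c)} \<union> R) = weights S ({(a, b), (c, d)} \<union> R)"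
    "weights S ({(c, d), (a, b)} \<union> R) = weights S ({(a, b), (c, d)} \<union> R)"
    by (auto simp: weights_def)
  then show "splits S ({(b, a), (c, d)} \<union> R)" "splits S ({(a, b), (d, c)} \<union> R)"
    "splits S ({(c, d), (a, b)} \<union> R)"
    using assms unfolding splits_def by simp_all
qed

text \<open>
  The new leaf \<open>k\<close> takes the place of \<open>g\<close> in its pair, since the weights
  and the energies of \<open>g'\<close> and \<open>k\<close> agree.
\<close>
lemma pairs_up_attach_chain:
  assumes grown: "grown v\<^sub>0 S F" and g: "base g \<in> S" "base g' \<in> V - S" "edge g = edge g'"
    and pu: "pairs_up S F" and w: "{h. base h = base g'} = {g', k}" "g' \<noteq> k"
  shows "pairs_up (insert (base g') S) (insert (edge g) F)"
proof -
  let ?S = "insert (base g') S" and ?F = "insert (edge g) F"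
  have gL: "g \<in> leaves S F" and L': "leaves ?S ?F = insert k (leaves S F - {g})"
    using leaves_attach[OF grown g] w by auto
  have kw: "base k = base g'" using w by auto
  have rg: "r (edge g) = r (edge k)" using degree_two_energy[OF _ w] g by simp
  have *: "splits ?S ({(k, b), (c, d)} \<union> mates ?F)"
    if dist: "distinct [k, b, c, d]" and L: "leaves ?S ?F = {k, b, c, d}"
      and r: "r (edge k) = r (edge b)" "r (edge c) = r (edge d)" for b c d
  proof -
    have S: "base b \<in> S" "base c \<in> S" "base d \<in> S" "b \<noteq> g" "c \<noteq> g" "d \<noteq> g"
      using L dist unfolding L' by (auto simp: leaves_def)
    have "k \<notin> leaves S F" using kw g by (auto simp: leaves_def)
    then have "leaves S F - {g} = {b, c, d}" using L dist unfolding L' by auto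
    then have "leaves S F = {g, b, c, d}" using gL by auto
    then have "splits S ({(g, b), (c, d)} \<union> mates F)"
      using pu[unfolded pairs_up_def, rule_format, of g b c d] dist r rg S by auto
    then show ?thesis
    proof (rule splits_attach[OF grown g])
      show "splits {base g'} {(g', k)}" using splits_vertex[of "base g'"] g kw by simp
      fix x y h l
      assume x: "x \<in> weights S ({(g, b), (c, d)} \<union> mates F)" and y: "y \<in> weights {base g'} {(g', k)}"
        and hl: "(h, l) \<in> {(k, b), (c, d)}"
      have "x $ g = x $ b" "x $ c = x $ d" "y $ g' = y $ k"
        using in_weightsD(3)[OF x] in_weightsD(3)[OF y] by auto
      then show "join S g g' x y $ h = join S g g' x y $ l"
        using hl S kw g(2) by (auto simp: join_def)
    qed
  qed
  show ?thesis
    unfolding pairs_up_def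
  proof (intro allI impI, elim conjE)
    fix a b c d
    assume dist: "distinct [a, b, c, d]" and L: "leaves ?S ?F = {a, b, c, d}"
      and r: "r (edge a) = r (edge b)" "r (edge c) = r (edge d)"
    have "k \<in> {a, b, c, d}" using L L' by blast
    then consider "k = a" | "k = b" | "k = c" | "k = d" by blast
    then show "splits ?S ({(a, b), (c, d)} \<union> mates ?F)"
    proof cases
      case 1
      then show ?thesis using * dist L r by simp
    next
      case 2
      then have "splits ?S ({(b, a), (c, d)} \<union> mates ?F)"
        using *[of a c d] dist L r by (auto simp: insert_commute)
      then show ?thesis by (rule splits_pairing_symmetries)
    next
      case 3
      then have "splits ?S ({(c, d), (a, b)} \<union> mates ?F)"
        using *[of d a b] dist L r by (auto simp: insert_commute)
      then show ?thesis by (rule splits_pairing_symmetries)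
    next
      case 4
      then have "splits ?S ({(d, c), (a, b)} \<union> mates ?F)"
        using *[of c a b] dist L r by (auto simp: insert_commute)
      from splits_pairing_symmetries(2)[OF splits_pairing_symmetries(3)[OF this]] show ?thesis .
    qed
  qed
qed

text \<open>
  The pairs are separated by the edge of \<open>g\<close>, so each of them can be made to agree in
  its own part before joining.
\<close>
lemma splits_dumbbell:
  assumes grown: "grown v\<^sub>0 S F" and g: "base g \<in> S" "base g' \<in> V - S" "edge g = edge g'"
    and v\<^sub>0: "v\<^sub>0 \<in> V" and ab: "base a \<in> S" "base b \<in> S" and cd: "base c = base g'" "base d = base g'"
  shows "splits (insert (base g') S) ({(a, b), (c, d)} \<union> mates (insert (edge g) F))"
proof (rule splits_attach[OF grown g])
  show "splits S ({(a, b)} \<union> mates F)" using splits_tree[OF grown v\<^sub>0 ab] by simp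
  show "splits {base g'} {(c, d)}" using splits_vertex[OF _ cd] g by blast
  fix x y h l
  assume x: "x \<in> weights S ({(a, b)} \<union> mates F)" and y: "y \<in> weights {base g'} {(c, d)}"
    and hl: "(h, l) \<in> {(a, b), (c, d)}"
  have "x $ a = x $ b" "y $ c = y $ d"
    using in_weightsD(3)[OF x] in_weightsD(3)[OF y] by auto
  then show "join S g g' x y $ h = join S g g' x y $ l"
    using hl ab cd g(2) by (auto simp: join_def)
qed

text \<open>
  Corresponding leaves of the old part and of the new vertex have equal energies. Hence the weights
  at the new vertex, carried to \<open>g\<close>, \<open>a\<close>, \<open>c\<close> in place of
  \<open>g'\<close>, \<open>b\<close>, \<open>d\<close>, balance there too, and they extend to the
  old part by \<open>\<kappa>\<close>.
\<close>
lemma splits_theta: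
  assumes grown: "grown v\<^sub>0 S F" and g: "base g \<in> S" "base g' \<in> V - S" "edge g = edge g'"
    and tr: "transfers S F"
    and L: "leaves S F = {g, a, c}" "distinct [g, a, c]"
    and w: "{h. base h = base g'} = {g', b, d}" "distinct [g', b, d]"
    and r: "r (edge a) = r (edge b)" "r (edge c) = r (edge d)"
  shows "splits (insert (base g') S) ({(a, b), (c, d)} \<union> mates (insert (edge g) F))"
proof -
  obtain \<kappa> where \<kappa>: "\<And>h. base h \<in> S \<Longrightarrow> \<kappa> h \<in> {g, a, c}" "\<And>h. h \<in> {g, a, c} \<Longrightarrow> \<kappa> h = h"
      "\<And>h k. (h, k) \<in> mates F \<Longrightarrow> \<kappa> h = \<kappa> k"
    and bal: "\<And>y p v. (\<forall>h\<in>{g, a, c}. (p h)\<^sup>2 = r (edge h) * y h) \<Longrightarrow> sum p {g, a, c} = 0 \<Longrightarrow> v \<in> S \<Longrightarrow>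
        balanced (\<chi> h. y (\<kappa> h)) v"
    using tr unfolding transfers_def L(1) by blast
  define m where "m h = (if h = g then g' else if h = a then b else d)" for h
  define f where "f z = (\<chi> h. if base h \<in> S then z $ (m (\<kappa> h)) else z $ h)"
    for z :: "real^'h"
  have S: "base a \<in> S" "base c \<in> S" "base b = base g'" "base d = base g'"
    using L w by (auto simp: leaves_def)
  have m: "m g = g'" "m a = b" "m c = d" using L by (auto simp: m_def)
  have fm: "f z $ g = z $ g'" "f z $ a = z $ b" "f z $ c = z $ d"
    "f z $ g' = z $ g'" "f z $ b = z $ b" "f z $ d = z $ d" for z
    using S g \<kappa>(2) m by (auto simp: f_def)
  have f: "f z \<in> weights (insert (base g') S) ({(a, b), (c, d)} \<union> mates (insert (edge g) F))"
    if z: "z \<in> weights {base g'} R" for z R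
  proof -
    have nn: "0 \<le> z $ h" for h using in_weightsD(1)[OF z] .
    have zw: "balanced z (base g')" using in_weightsD(2)[OF z] by simp
    then have 1: "balanced (f z) (base g')"
      using balanced_scaled[of z "base g'" 1 "f z"] g(2) by (auto simp: f_def)
    obtain p where p: "\<forall>h. base h = base g' \<longrightarrow> (p h)\<^sup>2 = r (edge h) * z $ h" "sum p {g', b, d} = 0"
      using zw unfolding balanced_def w by blast
    have 2: "balanced (f z) v" if v: "v \<in> S" for v
    proof -
      have "balanced (\<chi> h. z $ m (\<kappa> h)) v"
      proof (rule bal[OF _ _ v, where p = "\<lambda>h. p (m h)"])
        show "(\<Sum>h\<in>{g, a, c}. p (m h)) = 0" using p(2) L(2) w(2) by (simp add: m)
        show "\<forall>h\<in>{g, a, c}. (p (m h))\<^sup>2 = r (edge h) * z $ m h"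
          using p(1) S r g(3) by (simp add: m)
      qed
      then show ?thesis
        using balanced_scaled[of _ v 1 "f z"] v by (auto simp: f_def)
    qed
    have 3: "f z $ h = f z $ k" if hk: "(h, k) \<in> mates (insert (edge g) F)" for h k
    proof -
      have e: "edge h \<in> insert (edge g) F" "edge k = edge h" using hk by (auto simp: mates_def)
      show ?thesis
      proof (cases "edge h \<in> F")
        case True
        then have "(h, k) \<in> mates F" using e(2) by (simp add: mates_def)
        then show ?thesis
          using \<kappa>(3)[of h k] grown_base[OF grown, of h] grown_base[OF grown, of k] True e
          by (simp add: f_def)
      next
        case False
        have "f z $ l = z $ g'" if "edge l = edge g" for l
        proof -
          have "g \<noteq> g'" using g by auto
          then have "l = g \<or> l = g'" using halves_of_edge[OF g(3) _ that] by blast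
          then show ?thesis using fm by auto
        qed
        then show ?thesis using False e by simp
      qed
    qed
    have "0 \<le> f z $ h" for h using nn by (simp add: f_def)
    then show ?thesis using 1 2 3 fm unfolding weights_def by auto
  qed
  have "linear f" by (rule linearI) (auto simp: f_def vec_eq_iff)
  moreover have "f 1 = 1" by (auto simp: f_def vec_eq_iff)
  moreover have "splits {base g'} {(g', g')}" using splits_vertex[of "base g'"] g by simp
  ultimately show ?thesis
    using splits_by_linear_map[of f "{base g'}" "{(g', g')}"] f by (meson hull_inc image_subsetI)
qed

text \<open>
  Two of the four new leaves are old and two are at the new vertex. The pairs either separate old
  from new, as in a dumbbell, or match old with new, as in a theta graph.
\<close>
lemma pairs_up_attach_triangle:
  assumes grown: "grown v\<^sub>0 S F" and g: "base g \<in> S" "base g' \<in> V - S" "edge g = edge g'"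
    and v\<^sub>0: "v\<^sub>0 \<in> V" and tr: "transfers S F"
    and card: "card (leaves S F) = 3" "card {h. base h = base g'} = 3"
  shows "pairs_up (insert (base g') S) (insert (edge g) F)"
proof -
  let ?S = "insert (base g') S" and ?F = "insert (edge g) F"
  have gL: "g \<in> leaves S F" and L': "leaves ?S ?F = (leaves S F - {g}) \<union> ({h. base h = base g'} - {g'})"
    using leaves_attach[OF grown g] by auto
  obtain h1 h2 where h: "leaves S F = {g, h1, h2}" "distinct [g, h1, h2]"
    using card_3_obtain[OF card(1) gL] .
  obtain k1 k2 where k: "{h. base h = base g'} = {g', k1, k2}" "distinct [g', k1, k2]"
    using card_3_obtain[OF card(2), of g'] by blast
  have base: "base h1 \<in> S" "base h2 \<in> S" "base k1 = base g'" "base k2 = base g'"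
    using h k by (auto simp: leaves_def)
  have L: "leaves ?S ?F = {h1, h2, k1, k2}" using L' h k by auto
  have db: "splits ?S ({(a, b), (c, d)} \<union> mates ?F)"
    if "{a, b} = {h1, h2}" "{c, d} = {k1, k2}" for a b c d
  proof -
    have "a \<in> {h1, h2}" "b \<in> {h1, h2}" "c \<in> {k1, k2}" "d \<in> {k1, k2}" using that by blast+
    then show ?thesis using splits_dumbbell[OF grown g v\<^sub>0] base by blast
  qed
  have th: "splits ?S ({(a, b), (c, d)} \<union> mates ?F)"
    if "{a, c} = {h1, h2}" "{b, d} = {k1, k2}" "r (edge a) = r (edge b)" "r (edge c) = r (edge d)" for a b c d
  proof (rule splits_theta[OF grown g tr _ _ _ _ that(3,4)])
    show "leaves S F = {g, a, c}" unfolding that(1) by (rule h(1))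
    show "{h. base h = base g'} = {g', b, d}" unfolding that(2) by (rule k(1))
    show "distinct [g, a, c]" using that(1) h(2) by (simp add: doubleton_eq_iff) auto
    show "distinct [g', b, d]" using that(2) k(2) by (simp add: doubleton_eq_iff) auto
  qed
  show ?thesis
    unfolding pairs_up_def
  proof (intro allI impI, elim conjE)
    fix a b c d
    assume dist: "distinct [a, b, c, d]" and L2: "leaves ?S ?F = {a, b, c, d}"
      and r: "r (edge a) = r (edge b)" "r (edge c) = r (edge d)"
    let ?X = "{h1, h2}" and ?Y = "{k1, k2}"
    have "?X \<inter> ?Y = {}" using base g(2) by auto
    moreover have "?X \<union> ?Y = {a, b, c, d}" unfolding L2[symmetric] L by auto
    moreover have "card ?X = 2" using h(2) by simp
    ultimately consider "{a, b} = ?X" "{c, d} = ?Y" | "{c, d} = ?X" "{a, b} = ?Y"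
      | "{a, c} = ?X" "{b, d} = ?Y" | "{a, d} = ?X" "{b, c} = ?Y"
      | "{b, c} = ?X" "{a, d} = ?Y" | "{b, d} = ?X" "{a, c} = ?Y"
      using two_plus_two[OF dist, of ?X ?Y] by metis
    then show "splits ?S ({(a, b), (c, d)} \<union> mates ?F)"
    proof cases
      case 1
      then show ?thesis by (rule db)
    next
      case 2
      from splits_pairing_symmetries(3)[OF db[OF this]] show ?thesis .
    next
      case 3
      then show ?thesis using r by (rule th)
    next
      case 4
      from splits_pairing_symmetries(2)[OF th[OF this r(1) r(2)[symmetric]]] show ?thesis .
    next
      case 5
      from splits_pairing_symmetries(1)[OF th[OF this r(1)[symmetric] r(2)]] show ?thesis .
    next
      case 6
      from splits_pairing_symmetries(2)[OF splits_pairing_symmetries(1)[OF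
          th[OF this r(1)[symmetric] r(2)[symmetric]]]]
      show ?thesis .
    qed
  qed
qed

text \<open>
  Attaching a vertex of degree \<open>d\<close> raises the number of leaves by \<open>d - 2\<close>.
  As there are at least three from the start, a tree with three leaves has only vertices of degree 2
  besides its root, and one with four has either a root of degree 4 or exactly one further vertex of
  degree 3.
\<close>
lemma grown_branching:
  assumes "grown v\<^sub>0 S F" "v\<^sub>0 \<in> V" "3 \<le> card {h. base h = v\<^sub>0}"
  shows "3 \<le> card (leaves S F) \<and> (card (leaves S F) = 3 \<longrightarrow> transfers S F) \<and>
    (card (leaves S F) = 4 \<longrightarrow> pairs_up S F)"
  using assms
proof (induction rule: grown.induct)
  case root
  then show ?case using pairs_up_root transfers_root by (simp add: leaves_def)
next
  case (attach S F g g')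
  let ?L = "leaves S F" and ?L' = "leaves (insert (base g') S) (insert (edge g) F)"
  let ?H = "{h. base h = base g'}"
  note g = attach.hyps
  have card: "card ?L' + 2 = card ?L + card ?H" by (rule card_leaves_attach[OF g])
  have H: "2 \<le> card ?H" using two_halves g by auto
  note IH = attach.IH[OF attach.prems]
  have two: "\<exists>k. ?H = {g', k} \<and> g' \<noteq> k" if "card ?H = 2"
  proof -
    have "card (?H - {g'}) = 1" using that by (simp add: card_Diff_singleton)
    then obtain k where "?H - {g'} = {k}" by (meson card_1_singletonE)
    then show ?thesis by (intro exI[of _ k]) auto
  qed
  have 1: "3 \<le> card ?L'" using card H IH by linarith
  have 2: "transfers (insert (base g') S) (insert (edge g) F)" if "card ?L' = 3"
  proof -
    have "card ?L = 3" "card ?H = 2" using card H IH that by linarith+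
    then show ?thesis using two transfers_attach[OF g] IH by blast
  qed
  have 3: "pairs_up (insert (base g') S) (insert (edge g) F)" if "card ?L' = 4"
  proof -
    have "card ?L = 4 \<and> card ?H = 2 \<or> card ?L = 3 \<and> card ?H = 3" using card H IH that by linarith
    then show ?thesis
      using two pairs_up_attach_chain[OF g] pairs_up_attach_triangle[OF g] IH attach.prems by blast
  qed
  show ?case using 1 2 3 by blast
qed

end

section \<open>Metric graphs\<close>

definition base :: "('v, 'e) pre_digraph \<Rightarrow> 'e \<times> bool \<Rightarrow> 'v" where
  "base G h = (if snd h then tail G (fst h) else head G (fst h))"

lemma base_simps [simp]: "base G (e, True) = tail G e" "base G (e, False) = head G e"
  by (simp_all add: base_def)

context metric_graph
begin

lemma sum_halves:
  "(\<Sum>h | base G h = v. f h) = (\<Sum>e\<in>out_arcs G v. f (e, True)) + (\<Sum>e\<in>in_arcs G v. f (e, False))"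
proof -
  have "{h. base G h = v} = (\<lambda>e. (e, True)) ` out_arcs G v \<union> (\<lambda>e. (e, False)) ` in_arcs G v"
    by (auto simp: base_def out_arcs_def in_arcs_def arcs_UNIV image_iff split: if_splits)
  also have "sum f \<dots> = sum f ((\<lambda>e. (e, True)) ` out_arcs G v) + sum f ((\<lambda>e. (e, False)) ` in_arcs G v)"
    by (rule sum.union_disjoint) auto
  also have "\<dots> = (\<Sum>e\<in>out_arcs G v. f (e, True)) + (\<Sum>e\<in>in_arcs G v. f (e, False))"
    by (simp add: sum.reindex inj_on_def)
  finally show ?thesis .
qed

lemma card_halves: "card {h. base G h = v} = degree G v"
proof -
  have "card {h. base G h = v} = (\<Sum>h | base G h = v. 1)" by simp
  also have "\<dots> = degree G v" unfolding sum_halves by (simp add: degree_def in_degree_def out_degree_def)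
  finally show ?thesis .
qed

lemma head_in_verts: "head G e \<in> internal G \<union> exterior G"
  using head_in_verts[of e] arcs_UNIV verts_split by auto

lemma finite_internal: "finite (internal G)"
  using finite_verts verts_split by simp

lemma internal_exterior_disjoint: "internal G \<inter> exterior G = {}"
  by (auto simp: internal_def exterior_def)

lemma exterior_in_arc:
  assumes "x \<in> exterior G"
  shows "\<exists>e. in_arcs G x = {e}"
proof -
  have "out_arcs G x = {}"
    using tail_internal internal_exterior_disjoint assms by (fastforce simp: out_arcs_def)
  then have "card (in_arcs G x) = 1"
    using assms by (simp add: exterior_def degree_def in_degree_def out_degree_def)
  then show ?thesis by (rule card_1_singletonE) blast
qed

text \<open>
  An exterior vertex has degree 1 and is never a tail, so it is the head of exactly one edge.
\<close>
lemma card_terminal_edges: "card {e. \<not> internal_edge G e} = card (exterior G)"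
proof (rule bij_betw_same_card)
  show "bij_betw (head G) {e. \<not> internal_edge G e} (exterior G)"
  proof (rule bij_betwI')
    fix e f
    assume ef: "e \<in> {e. \<not> internal_edge G e}" "f \<in> {e. \<not> internal_edge G e}"
    have "head G e \<in> exterior G"
      using ef head_in_verts tail_internal by (auto simp: internal_edge_def)
    then show "(head G e = head G f) = (e = f)"
      using exterior_in_arc[of "head G e"] by (auto simp: in_arcs_def arcs_UNIV set_eq_iff)
  next
    fix e assume "e \<in> {e. \<not> internal_edge G e}"
    then show "head G e \<in> exterior G"
      using head_in_verts tail_internal by (auto simp: internal_edge_def)
  next
    fix x assume x: "x \<in> exterior G"
    then obtain e where "in_arcs G x = {e}" using exterior_in_arc by blast
    then have "head G e = x" by (auto simp: in_arcs_def)
    then show "\<exists>e\<in>{e. \<not> internal_edge G e}. x = head G e"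
      using x internal_exterior_disjoint by (auto simp: internal_edge_def)
  qed
qed

lemma card_internal_edges:
  "int (card {e. internal_edge G e}) = betti1 G + int (card (internal G)) - 1"
proof -
  have "(UNIV :: 'e set) = {e. internal_edge G e} \<union> {e. \<not> internal_edge G e}" by auto
  then have "card (arcs G) = card {e. internal_edge G e} + card {e. \<not> internal_edge G e}"
    unfolding arcs_UNIV by (subst card_Un_disjoint[symmetric]) auto
  moreover have "card (verts G) = card (internal G) + card (exterior G)"
    unfolding verts_split
    by (rule card_Un_disjoint) (use finite_verts verts_split internal_exterior_disjoint in auto)
  ultimately show ?thesis by (simp add: betti1_def card_terminal_edges)
qed

text \<open>
  Otherwise \<open>S\<close> together with the exterior vertices attached to it would be closed
  under adjacency.
\<close>
lemma internal_crossing_edge: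
  assumes "S \<subset> internal G" "S \<noteq> {}"
  shows "\<exists>g g'. base G g \<in> S \<and> base G g' \<in> internal G - S \<and> fst g = fst g'"
proof (rule ccontr)
  assume none: "\<not> ?thesis"
  then have out: "head G e \<in> S \<longleftrightarrow> tail G e \<in> S" if "head G e \<in> internal G" for e
    using that tail_internal[of e] by (metis DiffI base_simps fst_conv)
  \<comment> \<open>Inside \<open>internal G\<close> nothing is added to \<open>S\<close>, by \<open>out\<close>.\<close>
  define S' where "S' = S \<union> (head G ` {e. tail G e \<in> S})"
  have S'_int: "x \<in> S' \<longleftrightarrow> x \<in> S" if "x \<in> internal G" for x
    using that out by (auto simp: S'_def)
  have closed_step: "y \<in> S'" if xS': "x \<in> S'" and e: "(x, y) = (tail G e, head G e) \<or> (x, y) = (head G e, tail G e)" for x y e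
  proof (cases "x = tail G e \<and> y = head G e")
    case True
    then have "x \<in> S" using that S'_int tail_internal by auto
    then show ?thesis using True by (auto simp: S'_def)
  next
    case False
    then have xy: "x = head G e" "y = tail G e" using e by auto
    show ?thesis
    proof (cases "x \<in> internal G")
      case True
      then show ?thesis using out[of e] xy S'_int that by (auto simp: S'_def)
    next
      case False
      then have x: "x \<in> exterior G" using xy head_in_verts by auto
      obtain f where "in_arcs G x = {f}" using exterior_in_arc[OF x] by blast
      then have f: "f' = f" if "head G f' = x" for f' using that by (auto simp: in_arcs_def arcs_UNIV)
      have "x \<notin> S" using False assms by auto
      then obtain f' where "x = head G f'" "tail G f' \<in> S" using xS' by (auto simp: S'_def)
      then show ?thesis using f xy by (auto simp: S'_def)
    qed
  qed
  obtain a b where ab: "a \<in> S" "b \<in> internal G - S" using assms by auto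
  then have "a \<in> verts G" "b \<in> verts G" using assms verts_split by auto
  then have "a \<rightarrow>\<^sup>*\<^bsub>mk_symmetric G\<^esub> b"
    using connected by (auto simp: connected_def strongly_connected_def)
  then have "(a, b) \<in> (parcs (mk_symmetric G))\<^sup>*"
    using reachable_rtranclI by fastforce
  then have "b \<in> S'"
  proof (induction rule: rtrancl_induct)
    case base
    then show ?case using ab by (simp add: S'_def)
  next
    case (step y z)
    then obtain e where "(y, z) = (tail G e, head G e) \<or> (y, z) = (head G e, tail G e)"
      by (auto simp: parcs_mk_symmetric)
    then show ?case using closed_step step.IH by blast
  qed
  then show False using S'_int ab by auto
qed

lemma internal_nonempty: "internal G \<noteq> {}"
  using tail_internal by auto

text \<open>
  Transport along an edge is a rotation of the pair of value and derivative.
\<close>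
lemma energy_at_head:
  assumes "regular_state G bc \<theta> \<phi> pt ph" "internal_edge G e"
  shows "(\<phi> (tail G e))\<^sup>2 + (pt $ e)\<^sup>2 = (\<phi> (head G e))\<^sup>2 + (ph $ e)\<^sup>2"
proof -
  have rot: "\<phi> (head G e) = \<phi> (tail G e) * cos (\<theta> $ e) + pt $ e * sin (\<theta> $ e)"
    "- ph $ e = - \<phi> (tail G e) * sin (\<theta> $ e) + pt $ e * cos (\<theta> $ e)"
    using assms by (auto simp: regular_state_def)
  have "(\<phi> (head G e))\<^sup>2 + (- ph $ e)\<^sup>2
      = ((\<phi> (tail G e))\<^sup>2 + (pt $ e)\<^sup>2) * ((sin (\<theta> $ e))\<^sup>2 + (cos (\<theta> $ e))\<^sup>2)"
    unfolding rot by algebra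
  then show ?thesis by simp
qed

lemma regular_state_energies:
  assumes "regular_state G bc \<theta> \<phi> pt ph"
  shows "balanced_network (base G) fst (internal G) (\<lambda>e. (\<phi> (tail G e))\<^sup>2 + (pt $ e)\<^sup>2)"
proof
  show "finite (internal G)" by (rule finite_internal)
  show "h = g \<or> h = g'" if "fst g = fst g'" "g \<noteq> g'" "fst h = fst g" for g g' h :: "'e \<times> bool"
  proof (rule ccontr)
    assume "\<not> ?thesis"
    then have "snd h \<noteq> snd g" "snd h \<noteq> snd g'" "snd g \<noteq> snd g'"
      using that by (auto simp: prod_eq_iff)
    then show False by blast
  qed
  fix v assume v: "v \<in> internal G"
  then show "2 \<le> card {h. base G h = v}" by (simp add: card_halves internal_def)
  define p where "p h = (if snd h then pt $ fst h else ph $ fst h)" for h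
  have "(\<phi> (tail G (fst h)))\<^sup>2 + (pt $ fst h)\<^sup>2 = (\<phi> v)\<^sup>2 + (p h)\<^sup>2" if h: "base G h = v" for h
  proof (cases "snd h")
    case True
    then show ?thesis using h by (simp add: base_def p_def)
  next
    case False
    obtain e where e: "h = (e, False)" using False by (cases h) auto
    then have "internal_edge G e" using h v tail_internal by (simp add: internal_edge_def)
    then have "(\<phi> (tail G e))\<^sup>2 + (pt $ e)\<^sup>2 = (\<phi> (head G e))\<^sup>2 + (ph $ e)\<^sup>2"
      by (rule energy_at_head[OF assms])
    then show ?thesis using e h by (simp add: p_def)
  qed
  moreover have "sum p {h. base G h = v} = 0"
    using assms v by (simp add: sum_halves p_def regular_state_def)
  ultimately show "\<exists>x p. (\<forall>h. base G h = v \<longrightarrow> (\<phi> (tail G (fst h)))\<^sup>2 + (pt $ fst h)\<^sup>2 = x\<^sup>2 + (p h)\<^sup>2) \<and>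
      sum p {h. base G h = v} = 0"
    by blast
qed

text \<open>
  The parity of an internal edge is \<open>1\<close> if the two derivatives are opposite and
  \<open>-1\<close> if they are equal. This is also right for a loop, where \<open>1 -
  \<sigma>\<close> adds up both of its derivatives.
\<close>
lemma signed_vector_in_singular_cone:
  assumes sum: "\<And>v. v \<in> internal G \<Longrightarrow> (\<Sum>h | base G h = v. q h) = 0"
    and sq: "\<And>e. internal_edge G e \<Longrightarrow> (q (e, False))\<^sup>2 = (q (e, True))\<^sup>2"
  shows "(\<chi> e. (q (e, True))\<^sup>2) \<in> singular_cone G bc"
proof -
  define A where "A = (\<chi> e. q (e, True))"
  define \<theta> where "\<theta> = (\<chi> e. if internal_edge G e then (if q (e, False) = - q (e, True) then 0 else pi)
    else (case bc (head G e) of Dirichlet \<Rightarrow> 0 | Neumann \<Rightarrow> pi / 2))"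
  have "\<theta> \<in> singular_sectors G bc"
    by (auto simp: singular_sectors_def \<theta>_def split: boundary_condition.split)
  moreover have "A \<in> B_kernel G \<theta>"
    unfolding B_kernel_def
  proof (intro CollectI ballI)
    fix v assume v: "v \<in> internal G"
    have "B_matrix G \<theta> v e * A $ e
        = (if tail G e = v then q (e, True) else 0) + (if head G e = v then q (e, False) else 0)" for e
    proof (cases "internal_edge G e")
      case True
      have "q (e, False) = - (cos (\<theta> $ e) * q (e, True))"
        using sq[OF True] True by (auto simp: \<theta>_def power2_eq_iff)
      then show ?thesis using True by (auto simp: B_matrix_def A_def algebra_simps)
    next
      case False
      then have "head G e \<noteq> v" using v tail_internal by (auto simp: internal_edge_def)
      then show ?thesis using False by (auto simp: B_matrix_def A_def)
    qed
    then have "(\<Sum>e\<in>UNIV. B_matrix G \<theta> v e * A $ e)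
        = (\<Sum>e\<in>UNIV. if tail G e = v then q (e, True) else 0)
        + (\<Sum>e\<in>UNIV. if head G e = v then q (e, False) else 0)"
      by (simp add: sum.distrib)
    also have "\<dots> = (\<Sum>h | base G h = v. q h)"
      unfolding sum_halves out_arcs_def in_arcs_def arcs_UNIV by (simp add: sum.If_cases)
    finally show "(\<Sum>e\<in>UNIV. B_matrix G \<theta> v e * A $ e) = 0" using sum[OF v] by simp
  qed
  moreover have "(\<chi> e. (q (e, True))\<^sup>2) = squares A" by (simp add: squares_def A_def)
  ultimately show ?thesis unfolding singular_cone_def by (intro hull_inc UN_I image_eqI)
qed

lemma splits_imp_singular_cone:
  assumes "balanced_network (base G) fst (internal G) r"
    and splits: "balanced_network.splits (base G) fst r (internal G) R"
    and R: "\<And>e. internal_edge G e \<Longrightarrow> ((e, True), (e, False)) \<in> R"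
  shows "(\<chi> e. r e) \<in> singular_cone G bc"
proof -
  interpret balanced_network "base G" fst "internal G" r by fact
  define f where "f z = (\<chi> e. r e * z $ (e, True))" for z :: "real^('e \<times> bool)"
  have f: "f z \<in> singular_cone G bc" if z: "z \<in> weights (internal G) R" for z
  proof -
    have "\<forall>v\<in>internal G. \<exists>p. (\<forall>h. base G h = v \<longrightarrow> (p h)\<^sup>2 = r (fst h) * z $ h) \<and>
        sum p {h. base G h = v} = 0"
      using z by (auto simp: weights_def balanced_def)
    then obtain p where p: "\<And>v h. v \<in> internal G \<Longrightarrow> base G h = v \<Longrightarrow> (p v h)\<^sup>2 = r (fst h) * z $ h"
      "\<And>v. v \<in> internal G \<Longrightarrow> sum (p v) {h. base G h = v} = 0"
      by metis
    define q where "q h = p (base G h) h" for h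
    have q: "(q h)\<^sup>2 = r (fst h) * z $ h" if "base G h \<in> internal G" for h
      using p(1) that by (simp add: q_def)
    have "(\<Sum>h | base G h = v. q h) = 0" if "v \<in> internal G" for v
    proof -
      have "(\<Sum>h | base G h = v. q h) = sum (p v) {h. base G h = v}"
        by (rule sum.cong) (auto simp: q_def)
      then show ?thesis using p(2) that by simp
    qed
    moreover have "(q (e, False))\<^sup>2 = (q (e, True))\<^sup>2" if "internal_edge G e" for e
      using q[of "(e, True)"] q[of "(e, False)"] that in_weightsD(3)[OF z R[OF that]]
      by (simp add: internal_edge_def)
    ultimately have "(\<chi> e. (q (e, True))\<^sup>2) \<in> singular_cone G bc"
      by (rule signed_vector_in_singular_cone)
    moreover have "(\<chi> e. (q (e, True))\<^sup>2) = f z"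
      using q tail_internal by (simp add: f_def vec_eq_iff)
    ultimately show ?thesis by simp
  qed
  have "linear f" by (rule linearI) (auto simp: f_def vec_eq_iff algebra_simps)
  then have "f 1 \<in> convex_cone hull (f ` weights (internal G) R)"
    using splits by (auto simp: splits_def convex_cone_hull_linear_image)
  also have "\<dots> \<subseteq> singular_cone G bc"
    by (rule hull_minimal) (use f in \<open>auto simp: singular_cone_def convex_cone_convex_cone_hull\<close>)
  finally show ?thesis by (simp add: f_def)
qed

text \<open>
  A spanning tree of the internal vertices misses exactly \<open>betti1 G\<close> internal edges,
  whose halves have to be given equal weights. For a tree there are none, because the tree path
  between the endpoints of such an edge would close up to a cycle. In the last case the spanning
  tree is rooted at a vertex of degree at least 3, which exists because the degrees add up to twice
  the number of edges.
\<close>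
lemma regular_energies_in_singular_cone:
  assumes reg: "balanced_network (base G) fst (internal G) r"
    and kind: "tree_graph G \<or> unicyclic G \<or> (closed_graph G \<and> betti1 G = 2)"
  shows "(\<chi> e. r e) \<in> singular_cone G bc"
proof -
  interpret balanced_network "base G" fst "internal G" r by fact
  have spanning: "\<exists>F. grown v (internal G) F" if "v \<in> internal G" for v
    by (rule grown_extends[OF internal_crossing_edge that grown.root])
  have F_internal: "internal_edge G e" if "grown v (internal G) F" "e \<in> F" for v F e
    using grown_base[OF that(1), of "(e, True)"] grown_base[OF that(1), of "(e, False)"] that(2)
    by (auto simp: internal_edge_def)
  have card_F: "int (card ({e. internal_edge G e} - F)) = betti1 G"
    if "grown v (internal G) F" "v \<in> internal G" for v F
  proof -
    have "F \<subseteq> {e. internal_edge G e}" using F_internal that(1) by auto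
    then have "int (card ({e. internal_edge G e} - F)) = int (card {e. internal_edge G e}) - int (card F)"
      by (simp add: card_Diff_subset card_mono of_nat_diff)
    then show ?thesis using card_internal_edges grown_card[OF that] by simp
  qed
  obtain v where v: "v \<in> internal G" using internal_nonempty by blast
  obtain F where F: "grown v (internal G) F" using spanning[OF v] by blast
  show ?thesis
    using kind
  proof (elim disjE)
    assume tree: "tree_graph G"
    have "e \<in> F" if e: "internal_edge G e" for e
    proof (rule ccontr)
      assume "e \<notin> F"
      obtain vs es where p: "tree_path (internal G) F (head G e) (tail G e) vs es"
        using grown_tree_path[OF F, of "head G e" "tail G e"] e by (auto simp: internal_edge_def)
      have ends: "base G ` {h. fst h = f} = {tail G f, head G f}" for f
        by (auto simp: base_def image_iff)
      have len: "length vs = Suc (length es)" "hd vs = head G e" "last vs = tail G e"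
        using p by (auto simp: tree_path_def)
      then have "vs \<noteq> []" by auto
      then have start: "vs ! 0 = head G e" "vs ! length es = tail G e"
        using len by (simp_all add: hd_conv_nth last_conv_nth)
      have "{tail G ((es @ [e]) ! i), head G ((es @ [e]) ! i)}
          = {vs ! i, vs ! (Suc i mod length (es @ [e]))}" if i: "i < length (es @ [e])" for i
      proof (cases "i = length es")
        case True
        then show ?thesis using start by simp
      next
        case False
        then show ?thesis using i p by (simp add: tree_path_def nth_append ends)
      qed
      then have "undirected_cycle G vs (es @ [e])"
        using p \<open>e \<notin> F\<close> unfolding undirected_cycle_def tree_path_def arcs_UNIV by auto
      then show False using tree by (auto simp: tree_graph_def)
    qed
    \<comment> \<open>Pairing a half with itself is no constraint.\<close>
    moreover have "splits (internal G) (insert ((undefined, True), (undefined, True)) (mates F))"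
      by (rule splits_tree[OF F v]) (simp_all add: tail_internal)
    ultimately show ?thesis
      by (intro splits_imp_singular_cone[OF reg]) (auto simp: mates_def)
  next
    assume "unicyclic G"
    then have "card ({e. internal_edge G e} - F) = 1" using card_F[OF F v] by (simp add: unicyclic_def)
    then obtain e where e: "{e. internal_edge G e} - F = {e}" by (rule card_1_singletonE)
    then have "internal_edge G e" by auto
    then have "splits (internal G) (insert ((e, True), (e, False)) (mates F))"
      by (intro splits_tree[OF F v]) (simp_all add: internal_edge_def)
    then show ?thesis
      by (rule splits_imp_singular_cone[OF reg]) (use e in \<open>auto simp: mates_def\<close>)
  next
    assume closed: "closed_graph G \<and> betti1 G = 2"
    have all: "internal_edge G e" for e
      using closed tail_internal head_in_verts by (auto simp: internal_edge_def closed_graph_def)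
    then have E: "{e. internal_edge G e} = UNIV" by auto
    have base_int: "base G h \<in> internal G" for h
      using all[of "fst h"] by (auto simp: internal_edge_def base_def)
    have "\<exists>v\<in>internal G. 3 \<le> card {h. base G h = v}"
    proof (rule ccontr)
      assume "\<not> ?thesis"
      then have le: "card {h. base G h = v} \<le> 2" if "v \<in> internal G" for v using that by force
      have "2 * CARD('e) = (\<Sum>h\<in>(UNIV :: ('e \<times> bool) set). 1)" by (simp add: card_cartesian_product flip: UNIV_Times_UNIV)
      also have "\<dots> = (\<Sum>v\<in>internal G. \<Sum>h | h \<in> UNIV \<and> base G h = v. 1)"
        by (rule sum.group[symmetric]) (use finite_internal base_int in auto)
      also have "\<dots> \<le> (\<Sum>v\<in>internal G. 2)"
        by (rule sum_mono) (use le in simp)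
      finally have "CARD('e) \<le> card (internal G)" by simp
      then show False using card_internal_edges closed unfolding E by simp
    qed
    then obtain u where u: "u \<in> internal G" "3 \<le> card {h. base G h = u}" by blast
    obtain F where F: "grown u (internal G) F" using spanning[OF u(1)] by blast
    have "card (- F) = 2" using card_F[OF F u(1)] closed by (simp add: E Compl_eq_Diff_UNIV)
    then obtain e f where ef: "- F = {e, f}" "e \<noteq> f" by (meson card_2_iff)
    have "leaves (internal G) F = {h. fst h \<in> - F}" using base_int by (auto simp: leaves_def)
    also have "\<dots> = {(e, True), (e, False), (f, True), (f, False)}" unfolding ef by auto
    finally have L: "leaves (internal G) F = {(e, True), (e, False), (f, True), (f, False)}" .
    have dist: "distinct [(e, True), (e, False), (f, True), (f, False)]" using ef by simp
    then have "card (leaves (internal G) F) = 4" using L distinct_card[OF dist] by simp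
    then have "pairs_up (internal G) F" using grown_branching[OF F u] by blast
    then have "splits (internal G) ({((e, True), (e, False)), ((f, True), (f, False))} \<union> mates F)"
      using dist L unfolding pairs_up_def by (metis fst_conv)
    then show ?thesis
      by (rule splits_imp_singular_cone[OF reg]) (use ef in \<open>auto simp: mates_def\<close>)
  qed
qed

lemma regular_energy_pos:
  assumes reg: "regular_state G bc \<theta> \<phi> pt ph"
  shows "0 < len \<bullet> edge_energy G \<phi> pt"
proof -
  have "\<exists>e. 0 < (\<phi> (tail G e))\<^sup>2 + (pt $ e)\<^sup>2"
  proof -
    consider v where "v \<in> internal G" "\<phi> v \<noteq> 0" | e where "pt $ e \<noteq> 0"
      | e where "internal_edge G e" "ph $ e \<noteq> 0"
      using reg by (auto simp: regular_state_def)
    then show ?thesis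
    proof cases
      case 1
      then have "card {h. base G h = v} \<noteq> 0" by (simp add: card_halves internal_def)
      then have "{h. base G h = v} \<noteq> {}" by (metis card.empty)
      then obtain h where h: "base G h = v" by blast
      obtain e where "h = (e, True) \<or> h = (e, False)" by (cases h) (metis (full_types))
      then show ?thesis
      proof
        assume "h = (e, True)"
        then show ?thesis using h 1 by (intro exI[of _ e]) (simp add: sum_power2_gt_zero_iff)
      next
        assume "h = (e, False)"
        then have "head G e = v" using h by simp
        then show ?thesis using energy_at_head[OF reg, of e] 1 tail_internal
          by (intro exI[of _ e]) (simp add: sum_power2_gt_zero_iff internal_edge_def)
      qed
    next
      case 2
      then show ?thesis by (intro exI[of _ e]) (simp add: sum_power2_gt_zero_iff)
    next
      case 3
      then show ?thesis using energy_at_head[OF reg, of e]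
        by (intro exI[of _ e]) (simp add: sum_power2_gt_zero_iff)
    qed
  qed
  then obtain e where "0 < (\<phi> (tail G e))\<^sup>2 + (pt $ e)\<^sup>2" by blast
  then show ?thesis
    unfolding inner_vec_def edge_energy_def using len_pos
    by (intro sum_pos2[of _ e]) (auto simp: less_imp_le)
qed

end

section \<open>The lower bound\<close>

lemma finite_singular_sectors: "finite (singular_sectors G bc)"
proof (rule finite_subset)
  let ?P = "PiE UNIV (\<lambda>_ :: 'a. {0, pi, pi / 2, 3 * pi / 2})"
  show "singular_sectors G bc \<subseteq> vec_lambda ` ?P"
  proof
    fix \<theta> assume \<theta>: "\<theta> \<in> singular_sectors G bc"
    have "\<theta> $ e \<in> {0, pi, pi / 2, 3 * pi / 2}" for e
    proof -
      have "if internal_edge G e then \<theta> $ e \<in> {0, pi} else case bc (head G e) of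
         Dirichlet \<Rightarrow> \<theta> $ e \<in> {0, pi} | Neumann \<Rightarrow> \<theta> $ e \<in> {pi / 2, 3 * pi / 2}"
        using \<theta> unfolding singular_sectors_def by blast
      then show ?thesis by (auto split: if_splits boundary_condition.splits)
    qed
    then have "(\<lambda>e. \<theta> $ e) \<in> ?P" by (intro PiE_I) (blast, simp)
    moreover have "\<theta> = vec_lambda (\<lambda>e. \<theta> $ e)" by simp
    ultimately show "\<theta> \<in> vec_lambda ` ?P" by blast
  qed
  show "finite (vec_lambda ` ?P)" by (intro finite_imageI finite_PiE) auto
qed

text \<open>
  Multiplied out, the bound is linear in the energies and includes \<open>A = 0\<close>.
\<close>
lemma C_sing_le_singular_ratio:
  assumes \<alpha>: "\<And>e. 0 \<le> \<alpha> $ e" and len: "\<And>e. 0 < len $ e"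
    and \<theta>: "\<theta> \<in> singular_sectors G bc" and A: "A \<in> B_kernel G \<theta>"
  shows "C_sing G bc \<alpha> len * (len \<bullet> squares A) \<le> \<alpha> \<bullet> squares A"
proof (cases "A = 0")
  case True
  then show ?thesis by (simp add: squares_def inner_vec_def)
next
  case False
  define ratio where "ratio A = (\<Sum>e\<in>UNIV. \<alpha> $ e * (A $ e)\<^sup>2) / (\<Sum>e\<in>UNIV. len $ e * (A $ e)\<^sup>2)" for A
  have nonneg: "0 \<le> ratio A" for A
    unfolding ratio_def using \<alpha> len by (intro divide_nonneg_nonneg sum_nonneg) (auto simp: less_imp_le)
  let ?T = "{\<theta> \<in> singular_sectors G bc. B_kernel G \<theta> \<noteq> {0}}"
  have "\<theta> \<in> ?T" using \<theta> A False by auto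
  then have "C_sing G bc \<alpha> len \<le> (INF A \<in> B_kernel G \<theta> - {0}. ratio A)"
    unfolding C_sing_def ratio_def using finite_singular_sectors[of G bc] by (intro Min_le) auto
  also have "\<dots> \<le> ratio A"
    using A False nonneg by (intro cINF_lower bdd_belowI2[where m = 0]) auto
  also have "ratio A = (\<alpha> \<bullet> squares A) / (len \<bullet> squares A)"
    by (simp add: ratio_def inner_vec_def squares_def)
  finally have *: "C_sing G bc \<alpha> len \<le> (\<alpha> \<bullet> squares A) / (len \<bullet> squares A)" .
  obtain e where "A $ e \<noteq> 0" using False by (auto simp: vec_eq_iff)
  then have "0 < len \<bullet> squares A"
    unfolding inner_vec_def squares_def using len
    by (intro sum_pos2[of _ e]) (auto simp: less_imp_le)
  then show ?thesis using * by (simp add: pos_le_divide_eq)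
qed

lemma C_sing_bounds_singular_cone:
  assumes \<alpha>: "\<And>e. 0 \<le> \<alpha> $ e" and len: "\<And>e. 0 < len $ e" and "r \<in> singular_cone G bc"
  shows "C_sing G bc \<alpha> len * (len \<bullet> r) \<le> \<alpha> \<bullet> r"
proof -
  let ?H = "{x. 0 \<le> (\<alpha> - C_sing G bc \<alpha> len *\<^sub>R len) \<bullet> x}"
  have "singular_cone G bc \<subseteq> ?H"
    unfolding singular_cone_def
  proof (rule hull_minimal)
    show "convex_cone ?H" by (rule convex_cone_halfspace_ge)
    show "(\<Union>\<theta>\<in>singular_sectors G bc. squares ` B_kernel G \<theta>) \<subseteq> ?H"
      using C_sing_le_singular_ratio[OF \<alpha> len] by (auto simp: inner_diff_left)
  qed
  then show ?thesis using assms(3) by (auto simp: inner_diff_left)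
qed

theorem corollary5p27:
  fixes G :: "('v, 'e::finite) pre_digraph"
    and bc :: "'v \<Rightarrow> boundary_condition"
    and len :: "real^'e"
  assumes "metric_graph G len"
    and "tree_graph G \<or> unicyclic G \<or> (closed_graph G \<and> betti1 G = 2)"
  shows "regular_energies G bc \<subseteq> singular_cone G bc \<and>
    (\<forall>r \<in> regular_energies G bc. \<forall>\<alpha> :: real^'e. (\<forall>e. 0 \<le> \<alpha> $ e) \<longrightarrow>
       (\<alpha> \<bullet> r) / (len \<bullet> r) \<ge> C_sing G bc \<alpha> len)"
proof -
  interpret metric_graph G len by fact
  have cone: "edge_energy G \<phi> pt \<in> singular_cone G bc"
    if "regular_state G bc \<theta> \<phi> pt ph" for \<theta> \<phi> pt ph
    using regular_energies_in_singular_cone[OF regular_state_energies[OF that] assms(2)]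
    by (simp add: edge_energy_def)
  have "C_sing G bc \<alpha> len \<le> (\<alpha> \<bullet> edge_energy G \<phi> pt) / (len \<bullet> edge_energy G \<phi> pt)"
    if "regular_state G bc \<theta> \<phi> pt ph" "\<forall>e. 0 \<le> \<alpha> $ e" for \<theta> \<phi> pt ph \<alpha>
    using C_sing_bounds_singular_cone[of \<alpha> len, OF _ len_pos cone[OF that(1)]] that
      regular_energy_pos[OF that(1)]
    by (simp add: pos_le_divide_eq)
  then show ?thesis
    using cone by (auto simp: regular_energies_def)
qed
end
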